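(* Let $(V,\sigma)$ be a finite-dimensional braided vector space over $\mathbb{C}$ with $\sigma$ a braiding of Hecke type, and let $\mathfrak{A}$ be an associative algebra. Suppose that $F,G\in\mathcal{E}^1(\mathfrak{A})^\sigma$ (i.e. $F,G:V\to V\otimes\mathfrak{A}$ are linear maps compatible with $\sigma$) and that $(F\circ G)^{\times k}=F^{\times k}\circ G^{\times k}$ for any $k\geq 1$. If $\sigma$ is of finite rank, then $$\det\nolimits_q(F\circ G)=(\det\nolimits_q F)(\det\nolimits_q G).$$
   Context: Everything is over $\mathbb{C}$. Let $(n)_\nu=\frac{1-\nu^n}{1-\nu}$, $(n)_\nu!=(1)_\nu\cdots(n)_\nu$, $(0)_\nu!=1$. Fix $q\in\mathbb{C}$ nonzero with $q^{-2}$ not a root of unity (so $(n)_{q^{-2}}\ne 0$ for all $n\ge1$, and $q^2\neq -1$). $V$ is a vector space of finite dimension $N$. A braiding on $V$ is an invertible $\sigma\in\mathrm{End}(V\otimes V)$ with $(\sigma\otimes I)(I\otimes\sigma)(\sigma\otimes I)=(I\otimes\sigma)(\sigma\otimes I)(I\otimes\sigma)$, where $I=\mathrm{id}_V$; $(V,\sigma)$ is called a braided space. It is of Hecke type if $(\sigma-q\,\mathrm{id}_{V^{\otimes 2}})(\sigma+q^{-1}\mathrm{id}_{V^{\otimes 2}})=0$. On $V^{\otimes n}$ put $\sigma_i=\mathrm{id}_{V^{\otimes (i-1)}}\otimes\sigma\otimes \mathrm{id}_{V^{\otimes (n-i-1)}}$; for $w\in\mathfrak{S}_n$ with reduced expression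 $w=s_{i_1}\cdots s_{i_l}$ ($s_i$ the transposition of $i,i+1$; permutations compose as functions) put $\sigma_w=\sigma_{i_1}\cdots\sigma_{i_l}$ (independent of the reduced expression). $l(w)$ is the length of $w$. $\mathfrak{S}_{m,n}$ is the set of $(m,n)$-shuffles: $w\in\mathfrak{S}_{m+n}$ with $w(1)<\cdots<w(m)$ and $w(m+1)<\cdots<w(m+n)$. Define, on $V^{\otimes(m+n)}$, $$\mathrm{Sh}^{\pm}_{m,n}=\frac{(m)_{q^{-2}}!\,(n)_{q^{-2}}!}{(m+n)_{q^{-2}}!}\sum_{w\in\mathfrak{S}_{m,n}}(-q)^{-l(w)}\sigma_{w^{\pm1}}.$$ The quantum shuffle product on $T(V)$ is $x\odot_\sigma y=\mathrm{Sh}^+_{m,n}(x\otimes y)$ for $x\in V^{\otimes m}$, $y\in V^{\otimes n}$ (scalar multiplication if $m$ or $n$ is $0$). The quantum exterior algebra $\bigwedge_\sigma V=\bigoplus_k\bigwedge_\sigma^kV$ is the graded subalgebra of $(T(V),\odot_\sigma)$ generated by $V$. With $A^{(1)}=I$ and $A^{(k)}=\frac{1}{(k)_{q^{-2}}!}\sum_{w\in\mathfrak{S}_k}(-q)^{-l(w)}\sigma_w$, one has $\bigwedge_\sigma^kV=\mathrm{Im}A^{(k)}\subset V^{\otimes k}$ for $k\ge1$ and $\bigwedge_\sigma^0V=\mathbb{C}$. For $m,n\ge1$, $\Delta_{m,n}:\bigwedge_\sigma^{m+n}V\to\bigwedge_\sigma^mV\otimes\bigwedge_\sigma^nV$ is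 the (well-defined) map determined by $\Delta_{m,n}A^{(m+n)}=(A^{(m)}\otimes A^{(n)})\mathrm{Sh}^-_{m,n}$. The braiding $\sigma$ is of finite rank if there is an integer $M\ge1$ (its rank) with $\dim\bigwedge_\sigma^MV=1$ and $\dim\bigwedge_\sigma^kV=0$ for all $k>M$. Let $\mathfrak{m}$ be the multiplication of $\mathfrak{A}$, $\tau$ the flip. For a linear map $F:V\to V\otimes\mathfrak{A}$, the $k$-fold cross product $F^{\times k}:V^{\otimes k}\to V^{\otimes k}\otimes\mathfrak{A}$ is given by $F^{\times1}=F$ and $F^{\times(k+1)}=(\mathrm{id}_{V^{\otimes(k+1)}}\otimes\mathfrak{m})(\mathrm{id}_V\otimes\tau\otimes\mathrm{id}_{\mathfrak{A}})(F\otimes F^{\times k})$. $F$ is compatible with $\sigma$ if $F^{\times2}\sigma=(\sigma\otimes\mathrm{id}_{\mathfrak{A}})F^{\times2}$; $\mathcal{E}^1(\mathfrak{A})^\sigma$ is the set of all such $F$. For a space $W$ and maps $P,Q:W\to W\otimes\mathfrak{A}$ the composition product is $P\circ Q=(\mathrm{id}_W\otimes\mathfrak{m})(P\otimes\mathrm{id}_{\mathfrak{A}})Q$ (used for $W=\bigwedge_\sigma^kV$ and for $W=V^{\otimes k}$). The product $\cdot$ on $\bigwedge_\sigma V\otimes\mathfrak{A}$ is $(\alpha\otimes a)\cdot(\beta\otimes b)=(\alpha\odot_\sigma\beta)\otimes ab$. Put $\mathcal{E}^k(\mathfrak{A})=\mathrm{Hom}_{\mathbb{C}}(\bigwedge_\sigma^kV,\bigwedge_\sigma^kV\otimes\mathfrak{A})$.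 For $F\in\mathcal{E}^m(\mathfrak{A})$, $G\in\mathcal{E}^n(\mathfrak{A})$ the (associative) convolution product is $F\ast G=\cdot\,(F\otimes G)\Delta_{m,n}\in\mathcal{E}^{m+n}(\mathfrak{A})$, and $F^{\ast k}$ denotes the $k$-fold convolution power. If $\sigma$ has rank $M$ and $\bigwedge_\sigma^MV=\mathbb{C}\omega$, the quantum determinant $\det_qF\in\mathfrak{A}$ of $F\in\mathcal{E}^1(\mathfrak{A})$ is the unique element with $F^{\ast M}(\omega)=\omega\otimes\det_qF$. *)

theory Defs
  imports Complex_Main "HOL-Combinatorics.Permutations" "HOL-Library.Function_Algebras"
begin

section \<open>Complex vector spaces and (not necessarily unital) associative algebras\<close>

class scaleC =
  fixes scaleC :: "complex \<Rightarrow> 'a \<Rightarrow> 'a"  (infixr "*\<^sub>C" 75)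

class complex_vector = scaleC + ab_group_add +
  assumes scaleC_add_right: "a *\<^sub>C (x + y) = a *\<^sub>C x + a *\<^sub>C y"
    and scaleC_add_left: "(a + b) *\<^sub>C x = a *\<^sub>C x + b *\<^sub>C x"
    and scaleC_scaleC: "a *\<^sub>C (b *\<^sub>C x) = (a * b) *\<^sub>C x"
    and scaleC_one: "1 *\<^sub>C x = x"

class complex_algebra = complex_vector + ring +
  assumes mult_scaleC_left: "(a *\<^sub>C x) * y = a *\<^sub>C (x * y)"
    and mult_scaleC_right: "x * (a *\<^sub>C y) = a *\<^sub>C (x * y)"

instantiation complex :: complex_algebra
begin
definition scaleC_complex :: "complex \<Rightarrow> complex \<Rightarrow> complex"
  where "scaleC_complex c x = c * x"
instance
  by standard (simp_all add: scaleC_complex_def algebra_simps)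
end

instantiation "fun" :: (type, complex_vector) complex_vector
begin
definition scaleC_fun :: "complex \<Rightarrow> ('a \<Rightarrow> 'b) \<Rightarrow> 'a \<Rightarrow> 'b"
  where "scaleC_fun c f = (\<lambda>x. c *\<^sub>C f x)"
instance
  by standard (simp_all add: scaleC_fun_def fun_eq_iff scaleC_add_right scaleC_add_left
      scaleC_scaleC scaleC_one)
end

global_interpretation cvs: vector_space "scaleC :: complex \<Rightarrow> 'a \<Rightarrow> 'a::complex_vector"
  by standard (simp_all add: scaleC_add_right scaleC_add_left scaleC_scaleC scaleC_one)

definition lin_maps ::
    "'v set \<Rightarrow> 'w set \<Rightarrow> ('v::complex_vector \<Rightarrow> 'w::complex_vector) set"
  where "lin_maps W U = {f. (\<forall>x\<in>W. f x \<in> U)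
      \<and> (\<forall>x\<in>W. \<forall>y\<in>W. f (x + y) = f x + f y)
      \<and> (\<forall>c. \<forall>x\<in>W. f (c *\<^sub>C x) = c *\<^sub>C f x)}"


section \<open>Tensor powers\<close>

text \<open>
  \<open>V\<close> is the space with basis indexed by the finite type \<open>'i\<close>.  A tensor with coefficients in \<open>'a\<close>
  is given by its coordinates: \<open>t w\<close> is the coefficient at the basis tensor
  \<open>e_{w_1} \<otimes> \<dots> \<otimes> e_{w_k}\<close>, for words \<open>w\<close> over \<open>'i\<close>.  Thus \<open>tpow k\<close> is \<open>V\<^sup>\<otimes>\<^sup>k\<close> when \<open>'a = complex\<close> and
  \<open>V\<^sup>\<otimes>\<^sup>k \<otimes> \<AA>\<close> when \<open>'a\<close> is the algebra \<open>\<AA>\<close>; in particular \<open>V = tpow 1\<close>.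
  A map defined on \<open>V\<^sup>\<otimes>\<^sup>k\<close> is a function on all of \<open>'i list \<Rightarrow> complex\<close> of which only the values on
  \<open>tpow k\<close> are relevant.
\<close>

type_synonym ('i, 'a) tensor = "'i list \<Rightarrow> 'a"

type_synonym ('i, 'a) tmap = "('i, complex) tensor \<Rightarrow> ('i, 'a) tensor"

definition tpow :: "nat \<Rightarrow> ('i, 'a::zero) tensor set"
  where "tpow k = {t. \<forall>w. length w \<noteq> k \<longrightarrow> t w = 0}"

definition words :: "nat \<Rightarrow> 'i list set"
  where "words k = {w. length w = k}"

definition ebasis :: "'i list \<Rightarrow> ('i, complex) tensor"
  where "ebasis u = (\<lambda>w. if w = u then 1 else 0)"

text \<open>The product \<open>(x \<otimes> a)(y \<otimes> b) = (x \<otimes> y) \<otimes> ab\<close> of \<open>T(V) \<otimes> \<AA>\<close>; for \<open>'a = complex\<close> this is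
  \<open>x \<otimes> y\<close>.\<close>

definition tprod :: "('i, 'a::ring) tensor \<Rightarrow> ('i, 'a) tensor \<Rightarrow> ('i, 'a) tensor"
  where "tprod x y = (\<lambda>w. \<Sum>j\<le>length w. x (take j w) * y (drop j w))"

text \<open>\<open>\<omega> \<otimes> a\<close>, for a scalar tensor \<open>\<omega>\<close> and \<open>a \<in> \<AA>\<close>.\<close>

definition tcoeff :: "('i, complex) tensor \<Rightarrow> 'a::complex_algebra \<Rightarrow> ('i, 'a) tensor"
  where "tcoeff x a = (\<lambda>w. x w *\<^sub>C a)"

text \<open>For \<open>f : V\<^sup>\<otimes>\<^sup>m \<rightarrow> V\<^sup>\<otimes>\<^sup>m \<otimes> \<AA>\<close> and \<open>g : V\<^sup>\<otimes>\<^sup>n \<rightarrow> V\<^sup>\<otimes>\<^sup>n \<otimes> \<AA>\<close>: the linear map on \<open>V\<^sup>\<otimes>\<^sup>m \<otimes> V\<^sup>\<otimes>\<^sup>n\<close> with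
  \<open>x \<otimes> y \<mapsto> f x g y\<close>, that is, \<open>(id \<otimes> \<mm>)(id \<otimes> \<tau> \<otimes> id)(f \<otimes> g)\<close>.  For \<open>'a = complex\<close> it is \<open>f \<otimes> g\<close>.\<close>

definition map_tensor ::
    "nat \<Rightarrow> nat \<Rightarrow> ('i::finite, 'a::complex_algebra) tmap \<Rightarrow> ('i, 'a) tmap \<Rightarrow> ('i, 'a) tmap"
  where "map_tensor m n f g t =
    (\<Sum>u\<in>words m. \<Sum>v\<in>words n. t (u @ v) *\<^sub>C tprod (f (ebasis u)) (g (ebasis v)))"

text \<open>\<open>f \<otimes> id\<close> on \<open>V\<^sup>\<otimes>\<^sup>k \<otimes> \<AA>\<close>, for \<open>f\<close> linear on \<open>V\<^sup>\<otimes>\<^sup>k\<close>.\<close>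

definition map_tensor_id ::
    "nat \<Rightarrow> ('i::finite, complex) tmap \<Rightarrow> ('i, 'a::complex_algebra) tensor \<Rightarrow> ('i, 'a) tensor"
  where "map_tensor_id k f s = (\<lambda>w. \<Sum>u\<in>words k. f (ebasis u) w *\<^sub>C s u)"

text \<open>The composition product \<open>P \<circ> Q = (id \<otimes> \<mm>)(P \<otimes> id)Q\<close> for \<open>W = V\<^sup>\<otimes>\<^sup>k\<close>.\<close>

definition comp_prod ::
    "nat \<Rightarrow> ('i::finite, 'a::complex_algebra) tmap \<Rightarrow> ('i, 'a) tmap \<Rightarrow> ('i, 'a) tmap"
  where "comp_prod k P Q t = (\<lambda>w. \<Sum>u\<in>words k. P (ebasis u) w * Q t u)"

text \<open>The value at exponent 0 is a dummy.\<close>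

primrec cross_pow :: "('i::finite, 'a::complex_algebra) tmap \<Rightarrow> nat \<Rightarrow> ('i, 'a) tmap" where
  "cross_pow F 0 = (\<lambda>t. 0)"
| "cross_pow F (Suc k) = (if k = 0 then F else map_tensor 1 k F (cross_pow F k))"


section \<open>Braidings and their action on tensor powers\<close>

definition braiding :: "('i::finite, complex) tmap \<Rightarrow> bool"
  where "braiding \<sigma> \<longleftrightarrow>
    \<sigma> \<in> lin_maps (tpow 2) (tpow 2) \<and> bij_betw \<sigma> (tpow 2) (tpow 2) \<and>
    (\<forall>t\<in>tpow 3. map_tensor 2 1 \<sigma> id (map_tensor 1 2 id \<sigma> (map_tensor 2 1 \<sigma> id t))
               = map_tensor 1 2 id \<sigma> (map_tensor 2 1 \<sigma> id (map_tensor 1 2 id \<sigma> t)))"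

definition hecke_type :: "complex \<Rightarrow> ('i::finite, complex) tmap \<Rightarrow> bool"
  where "hecke_type q \<sigma> \<longleftrightarrow>
    (\<forall>t\<in>tpow 2. let s = \<sigma> t + inverse q *\<^sub>C t in \<sigma> s - q *\<^sub>C s = 0)"

definition compatible_maps ::
    "('i::finite, complex) tmap \<Rightarrow> ('i, 'a::complex_algebra) tmap set"
  where "compatible_maps \<sigma> = {F \<in> lin_maps (tpow 1) (tpow 1).
    \<forall>t\<in>tpow 2. cross_pow F 2 (\<sigma> t) = map_tensor_id 2 \<sigma> (cross_pow F 2 t)}"

text \<open>\<open>\<sigma>\<^sub>i\<close> on \<open>V\<^sup>\<otimes>\<^sup>n\<close>, for \<open>1 \<le> i < n\<close>.\<close>

definition braid_gen :: "('i::finite, complex) tmap \<Rightarrow> nat \<Rightarrow> nat \<Rightarrow> ('i, complex) tmap"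
  where "braid_gen \<sigma> n i =
    map_tensor (i - 1) (n - i + 1) id (map_tensor 2 (n - i - 1) \<sigma> id)"

definition word_perm :: "nat list \<Rightarrow> nat \<Rightarrow> nat"
  where "word_perm js = foldr (\<lambda>i p. transpose i (Suc i) \<circ> p) js id"

definition perm_length :: "nat \<Rightarrow> (nat \<Rightarrow> nat) \<Rightarrow> nat"
  where "perm_length n w =
    (LEAST l. \<exists>js. set js \<subseteq> {1..<n} \<and> word_perm js = w \<and> length js = l)"

definition reduced_word :: "nat \<Rightarrow> (nat \<Rightarrow> nat) \<Rightarrow> nat list \<Rightarrow> bool"
  where "reduced_word n w js \<longleftrightarrow>
    set js \<subseteq> {1..<n} \<and> word_perm js = w \<and> length js = perm_length n w"

text \<open>For a braiding, the choice of the reduced word does not matter.\<close>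

definition braid_perm ::
    "('i::finite, complex) tmap \<Rightarrow> nat \<Rightarrow> (nat \<Rightarrow> nat) \<Rightarrow> ('i, complex) tmap"
  where "braid_perm \<sigma> n w =
    foldr (\<lambda>i f. braid_gen \<sigma> n i \<circ> f) (SOME js. reduced_word n w js) id"


section \<open>Quantum shuffles and the quantum exterior algebra\<close>

definition qnum :: "complex \<Rightarrow> nat \<Rightarrow> complex"
  where "qnum \<nu> n = (1 - \<nu> ^ n) / (1 - \<nu>)"

definition qfact :: "complex \<Rightarrow> nat \<Rightarrow> complex"
  where "qfact \<nu> n = (\<Prod>k=1..n. qnum \<nu> k)"

definition shuffles_mn :: "nat \<Rightarrow> nat \<Rightarrow> (nat \<Rightarrow> nat) set"
  where "shuffles_mn m n = {w. w permutes {1..m + n}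
    \<and> strict_mono_on {1..m} w \<and> strict_mono_on {m + 1..m + n} w}"

definition sh_plus ::
    "complex \<Rightarrow> ('i::finite, complex) tmap \<Rightarrow> nat \<Rightarrow> nat \<Rightarrow> ('i, complex) tmap"
  where "sh_plus q \<sigma> m n t =
    (qfact (q powi -2) m * qfact (q powi -2) n / qfact (q powi -2) (m + n)) *\<^sub>C
    (\<Sum>w\<in>shuffles_mn m n.
       ((- q) powi (- int (perm_length (m + n) w))) *\<^sub>C braid_perm \<sigma> (m + n) w t)"

definition sh_minus ::
    "complex \<Rightarrow> ('i::finite, complex) tmap \<Rightarrow> nat \<Rightarrow> nat \<Rightarrow> ('i, complex) tmap"
  where "sh_minus q \<sigma> m n t =
    (qfact (q powi -2) m * qfact (q powi -2) n / qfact (q powi -2) (m + n)) *\<^sub>C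
    (\<Sum>w\<in>shuffles_mn m n.
       ((- q) powi (- int (perm_length (m + n) w))) *\<^sub>C braid_perm \<sigma> (m + n) (inv w) t)"

text \<open>The quantum shuffle product of \<open>x \<in> V\<^sup>\<otimes>\<^sup>m\<close> and \<open>y \<in> V\<^sup>\<otimes>\<^sup>n\<close>; if \<open>m = 0\<close> or \<open>n = 0\<close> the only shuffle
  is the identity, so the formula gives scalar multiplication.\<close>

definition qshuffle ::
    "complex \<Rightarrow> ('i::finite, complex) tmap \<Rightarrow> nat \<Rightarrow> nat \<Rightarrow>
     ('i, complex) tensor \<Rightarrow> ('i, complex) tensor \<Rightarrow> ('i, complex) tensor"
  where "qshuffle q \<sigma> m n x y = sh_plus q \<sigma> m n (tprod x y)"

text \<open>The graded subalgebra of \<open>T(V)\<close> with the quantum shuffle product that is generated by \<open>V\<close>: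
  \<open>in_qext q \<sigma> k x\<close> says that \<open>x\<close> is in its component of degree \<open>k\<close>.\<close>

inductive in_qext ::
    "complex \<Rightarrow> ('i::finite, complex) tmap \<Rightarrow> nat \<Rightarrow> ('i, complex) tensor \<Rightarrow> bool"
  for q :: complex and \<sigma> :: "('i::finite, complex) tmap" where
  unit: "in_qext q \<sigma> 0 (ebasis [])"
| gen: "v \<in> tpow 1 \<Longrightarrow> in_qext q \<sigma> 1 v"
| add: "in_qext q \<sigma> k x \<Longrightarrow> in_qext q \<sigma> k y \<Longrightarrow> in_qext q \<sigma> k (x + y)"
| scale: "in_qext q \<sigma> k x \<Longrightarrow> in_qext q \<sigma> k (c *\<^sub>C x)"
| mult: "in_qext q \<sigma> m x \<Longrightarrow> in_qext q \<sigma> n y \<Longrightarrow> in_qext q \<sigma> (m + n) (qshuffle q \<sigma> m n x y)"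

definition qext ::
    "complex \<Rightarrow> ('i::finite, complex) tmap \<Rightarrow> nat \<Rightarrow> ('i, complex) tensor set"
  where "qext q \<sigma> k = {x. in_qext q \<sigma> k x}"

definition antisymmetrizer ::
    "complex \<Rightarrow> ('i::finite, complex) tmap \<Rightarrow> nat \<Rightarrow> ('i, complex) tmap"
  where "antisymmetrizer q \<sigma> k t =
    (1 / qfact (q powi -2) k) *\<^sub>C
    (\<Sum>w | w permutes {1..k}. ((- q) powi (- int (perm_length k w))) *\<^sub>C braid_perm \<sigma> k w t)"

text \<open>\<open>\<Delta>\<^sub>m\<^sub>,\<^sub>n\<close> is given by \<open>\<Delta>\<^sub>m\<^sub>,\<^sub>n A\<^sup>(\<^sup>m\<^sup>+\<^sup>n\<^sup>) = (A\<^sup>(\<^sup>m\<^sup>) \<otimes> A\<^sup>(\<^sup>n\<^sup>)) Sh\<^sup>-\<^sub>m\<^sub>,\<^sub>n\<close>, so it is evaluated on an arbitrary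
  preimage under \<open>A\<^sup>(\<^sup>m\<^sup>+\<^sup>n\<^sup>)\<close>; the result does not depend on it.\<close>

definition qcoprod ::
    "complex \<Rightarrow> ('i::finite, complex) tmap \<Rightarrow> nat \<Rightarrow> nat \<Rightarrow> ('i, complex) tmap"
  where "qcoprod q \<sigma> m n z =
    map_tensor m n (antisymmetrizer q \<sigma> m) (antisymmetrizer q \<sigma> n)
      (sh_minus q \<sigma> m n (inv_into (tpow (m + n)) (antisymmetrizer q \<sigma> (m + n)) z))"


section \<open>Convolution, rank and quantum determinant\<close>

text \<open>The product \<open>(\<alpha> \<otimes> a) \<cdot> (\<beta> \<otimes> b) = (\<alpha> \<odot> \<beta>) \<otimes> ab\<close> in degrees \<open>m\<close> and \<open>n\<close>.\<close>

definition qext_alg_mult ::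
    "complex \<Rightarrow> ('i::finite, complex) tmap \<Rightarrow> nat \<Rightarrow> nat \<Rightarrow>
     ('i, 'a::complex_algebra) tensor \<Rightarrow> ('i, 'a) tensor \<Rightarrow> ('i, 'a) tensor"
  where "qext_alg_mult q \<sigma> m n x y = map_tensor_id (m + n) (sh_plus q \<sigma> m n) (tprod x y)"

text \<open>\<open>F\<close> and \<open>G\<close> are only meaningful on the exterior powers of degree \<open>m\<close> and \<open>n\<close>.  The composite of
  \<open>F \<otimes> G\<close> with the product is the linear map \<open>\<Phi>\<close> on the tensor product of these two spaces with
  \<open>\<Phi> (\<alpha> \<otimes> \<beta>) = F \<alpha> \<cdot> G \<beta>\<close>; it is represented by any linear extension to \<open>V\<^sup>\<otimes>\<^sup>(\<^sup>m\<^sup>+\<^sup>n\<^sup>)\<close>, and evaluated only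
  at \<open>\<Delta>\<^sub>m\<^sub>,\<^sub>n z\<close>, where its value is determined.\<close>

definition convolution ::
    "complex \<Rightarrow> ('i::finite, complex) tmap \<Rightarrow> nat \<Rightarrow> nat \<Rightarrow>
     ('i, 'a::complex_algebra) tmap \<Rightarrow> ('i, 'a) tmap \<Rightarrow> ('i, 'a) tmap"
  where "convolution q \<sigma> m n F G z =
    (SOME \<Phi>. \<Phi> \<in> lin_maps (tpow (m + n)) (tpow (m + n)) \<and>
       (\<forall>\<alpha>\<in>qext q \<sigma> m. \<forall>\<beta>\<in>qext q \<sigma> n.
          \<Phi> (tprod \<alpha> \<beta>) = qext_alg_mult q \<sigma> m n (F \<alpha>) (G \<beta>)))
    (qcoprod q \<sigma> m n z)"

text \<open>Convolution powers of \<open>F\<close> of degree 1; the value at exponent 0 is a dummy.\<close>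

primrec conv_pow ::
    "complex \<Rightarrow> ('i::finite, complex) tmap \<Rightarrow> ('i, 'a::complex_algebra) tmap \<Rightarrow> nat \<Rightarrow> ('i, 'a) tmap"
  where
  "conv_pow q \<sigma> F 0 = (\<lambda>t. 0)"
| "conv_pow q \<sigma> F (Suc k) = (if k = 0 then F else convolution q \<sigma> 1 k F (conv_pow q \<sigma> F k))"

definition braiding_rank :: "complex \<Rightarrow> ('i::finite, complex) tmap \<Rightarrow> nat \<Rightarrow> bool"
  where "braiding_rank q \<sigma> M \<longleftrightarrow>
    M \<ge> 1 \<and> cvs.dim (qext q \<sigma> M) = 1 \<and> (\<forall>k>M. cvs.dim (qext q \<sigma> k) = 0)"

text \<open>Here \<open>M\<close> is the rank and \<open>\<omega>\<close> spans the exterior power of degree \<open>M\<close>.\<close>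

definition qdet ::
    "complex \<Rightarrow> ('i::finite, complex) tmap \<Rightarrow> nat \<Rightarrow> ('i, complex) tensor \<Rightarrow>
     ('i, 'a::complex_algebra) tmap \<Rightarrow> 'a"
  where "qdet q \<sigma> M \<omega> F = (THE a. conv_pow q \<sigma> F M \<omega> = tcoeff \<omega> a)"

end

(*
  Write e = -1/q.  Because sigma is of Hecke type and q^(-2) is not a root of unity, the exterior power
  of degree k is both the image of the idempotent A^(k) and the space of tensors on which all sigma_i
  act as e.  The factorization of a permutation of {1..k+1} into a (1,k)-shuffle and a permutation of
  the last k letters gives A^(k+1) = Sh^+_{1,k} (id x A^(k)) = (id x A^(k)) Sh^-_{1,k}; hence Delta_{1,k}
  is the inclusion of the exterior power of degree k+1, on which Sh^+_{1,k} is the identity.  A cross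
  power of a compatible map commutes with every sigma_i, so by induction the convolution power F^{*k}
  is the restriction of F^{x k}.  On the line spanned by omega the hypothesis on the cross powers of
  F o G is then the multiplicativity of the determinant.
*)
theory Submission
  imports Defs
begin

section \<open>Inversions and reduced words\<close>

text \<open>The weights (-q)^(-l(w)) are the powers e^l(w), and on a common e-eigenvector sigma_w
  acts as e^l(w) as well. Each normalizing sum is therefore a length generating function at e^2 =
  q^(-2); this is where the q^(-2)-factorials come from, and excluding roots of unity allows
  division by them. The Hecke relation is used in the form that 1 + e sigma_i maps into the
  e-eigenspace of sigma_i, so the terms of w and s_i w in a shuffle sum combine to an eigenvector.
  General (m,n)-shuffles have to be treated because the subalgebra generated by V contains products
  of arbitrary degrees, whereas convolution powers of a map of degree 1 involve only (1,n)-shuffles.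
  Two choice operators stand in the way. sigma_w is read off from an arbitrarily chosen reduced
  word, so independence of the word needs a proof from the braid and commutation relations. The
  convolution uses an arbitrarily chosen extension of a map to a whole tensor power, so the
  coproduct of z must be exhibited as a combination of products on which all extensions
  agree.\<close>

abbreviation adj :: "nat \<Rightarrow> nat \<Rightarrow> nat"
  where "adj i \<equiv> transpose i (Suc i)"

definition inversions :: "nat \<Rightarrow> (nat \<Rightarrow> nat) \<Rightarrow> (nat \<times> nat) set"
  where "inversions n w = {(a, b). 1 \<le> a \<and> a < b \<and> b \<le> n \<and> w b < w a}"

text \<open>A computable stand-in for \<open>perm_length\<close>, which is a minimum over words;
  \<open>perm_length_eq_ninv\<close> identifies the two.\<close>

definition ninv :: "nat \<Rightarrow> (nat \<Rightarrow> nat) \<Rightarrow> nat"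
  where "ninv n w = card (inversions n w)"

lemma finite_inversions [simp]: "finite (inversions n w)"
  by (rule finite_subset[of _ "{1..n} \<times> {1..n}"]) (auto simp: inversions_def)

lemma ninv_id [simp]: "ninv n id = 0"
  by (simp add: ninv_def inversions_def) (metis (no_types, lifting) card.empty empty_Collect_eq not_less_iff_gr_or_eq case_prodE)

lemma adj_permutes: "1 \<le> i \<Longrightarrow> i < n \<Longrightarrow> adj i permutes {1..n}"
  by (rule permutes_swap_id) auto

lemma adj_comp_permutes:
  "w permutes {1..n} \<Longrightarrow> 1 \<le> i \<Longrightarrow> i < n \<Longrightarrow> adj i \<circ> w permutes {1..n}"
  by (intro permutes_compose adj_permutes)

lemma adj_adj_comp: "adj i \<circ> (adj i \<circ> w) = w"
  by (simp add: fun_eq_iff)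

lemma inv_adj_comp:
  assumes "w permutes {1..n::nat}"
  shows "inv (adj i \<circ> w) = inv w \<circ> adj i"
  using assms by (simp add: o_inv_distrib permutes_bij)

lemma inv_neq_Suc:
  assumes "w permutes {1..n::nat}"
  shows "inv w i \<noteq> inv w (Suc i)"
  using permutes_inj[OF permutes_inv[OF assms]] by (metis injD n_not_Suc_n)

text \<open>Left multiplication by s_i exchanges the values i and i+1, so the only pair of positions
  whose order can change is the pair holding these two values.\<close>

lemma inversions_adj:
  assumes w: "w permutes {1..n}" and i: "1 \<le> i" "i < n" and lt: "inv w i < inv w (Suc i)"
  shows "inversions n (adj i \<circ> w) = insert (inv w i, inv w (Suc i)) (inversions n w)"
    and "(inv w i, inv w (Suc i)) \<notin> inversions n w"
proof -
  have wi: "w (inv w x) = x" "inv w (w x) = x" for x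
    using permutes_inverses[OF w] by auto
  have rng: "inv w i \<in> {1..n}" "inv w (Suc i) \<in> {1..n}"
    using i permutes_in_image[OF permutes_inv[OF w]] by auto
  show "(inv w i, inv w (Suc i)) \<notin> inversions n w"
    by (simp add: inversions_def wi)
  have *: "adj i (w b) < adj i (w a) \<longleftrightarrow> w b < w a \<or> (a = inv w i \<and> b = inv w (Suc i))"
    if "a < b" for a b
  proof -
    have ab: "w a \<noteq> w b" using that wi(2) by (metis nat_neq_iff)
    have "\<not> (w b = i \<and> w a = Suc i)" using that lt wi by (metis not_less_iff_gr_or_eq)
    moreover have "w a = i \<longleftrightarrow> a = inv w i" "w b = Suc i \<longleftrightarrow> b = inv w (Suc i)" using wi by metis+
    ultimately show ?thesis using ab by (auto simp: transpose_def)
  qed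
  show "inversions n (adj i \<circ> w) = insert (inv w i, inv w (Suc i)) (inversions n w)"
    using * rng lt by (auto simp: inversions_def)
qed

lemma ninv_adj_up:
  assumes "w permutes {1..n}" "1 \<le> i" "i < n" "inv w i < inv w (Suc i)"
  shows "ninv n (adj i \<circ> w) = Suc (ninv n w)"
  using inversions_adj[OF assms] by (simp add: ninv_def)

lemma ninv_adj:
  assumes "1 \<le> i" "i < n"
  shows "ninv n (adj i) = 1"
  using ninv_adj_up[of id n i] assms by (simp add: permutes_id)

lemma ninv_adj_down:
  assumes w: "w permutes {1..n}" "1 \<le> i" "i < n" and "inv w (Suc i) < inv w i"
  shows "ninv n w = Suc (ninv n (adj i \<circ> w))"
  using ninv_adj_up[OF adj_comp_permutes[OF w] w(2,3)] assms(4)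
  unfolding adj_adj_comp by (simp add: inv_adj_comp[OF w(1)])

text \<open>An inversion (a, b) of \<open>w\<close> corresponds to the inversion (w b, w a) of the
  inverse. Inverting turns factorizations with the shuffle on the left into ones with an inverse
  shuffle on the right.\<close>

lemma ninv_inv:
  assumes w: "w permutes {1..n}"
  shows "ninv n (inv w) = ninv n w"
proof -
  have wi: "w (inv w x) = x" "inv w (w x) = x" for x
    using permutes_inverses[OF w] by auto
  have rng: "w x \<in> {1..n} \<longleftrightarrow> x \<in> {1..n}" "inv w x \<in> {1..n} \<longleftrightarrow> x \<in> {1..n}" for x
    using permutes_in_image[OF w] permutes_in_image[OF permutes_inv[OF w]] by blast+
  have "bij_betw (\<lambda>(a, b). (w b, w a)) (inversions n w) (inversions n (inv w))"
    by (rule bij_betw_byWitness[where f' = "\<lambda>(a, b). (inv w b, inv w a)"])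
       (use rng in \<open>fastforce simp: inversions_def wi\<close>)+
  then show ?thesis by (simp add: ninv_def bij_betw_same_card)
qed

lemma increasing_permutes_id:
  fixes w :: "nat \<Rightarrow> nat"
  assumes "w permutes {1..n}" and "\<And>i. 1 \<le> i \<Longrightarrow> i < n \<Longrightarrow> w i < w (Suc i)"
  shows "w = id"
  using assms
proof (induction n)
  case 0
  then show ?case by simp
next
  case (Suc n)
  have le: "i \<le> w i" if "i \<le> Suc n" for i
    using that
  proof (induction i)
    case (Suc j)
    then show ?case using Suc.prems \<open>\<And>i. 1 \<le> i \<Longrightarrow> i < Suc n \<Longrightarrow> w i < w (Suc i)\<close>[of j]
      permutes_in_image[OF \<open>w permutes {1..Suc n}\<close>, of "Suc j"] by (cases "j = 0") auto
  qed simp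
  have "w (Suc n) = Suc n"
    using le[of "Suc n"] permutes_in_image[OF Suc.prems(1), of "Suc n"] by auto
  then have "w permutes {1..n}"
    by (intro permutes_superset[OF Suc.prems(1)]) (auto simp: le_Suc_eq)
  then show ?case using Suc by simp
qed

lemma word_perm_Cons [simp]: "word_perm (i # js) = adj i \<circ> word_perm js"
  and word_perm_Nil [simp]: "word_perm [] = id"
  by (simp_all add: word_perm_def)

lemma word_perm_append: "word_perm (xs @ ys) = word_perm xs \<circ> word_perm ys"
  by (induction xs) (auto simp: o_assoc)

lemma word_perm_permutes: "set js \<subseteq> {1..<n} \<Longrightarrow> word_perm js permutes {1..n}"
proof (induction js)
  case (Cons i js)
  then show ?case unfolding word_perm_Cons by (intro adj_comp_permutes) auto
qed simp

lemma ninv_adj_le: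
  assumes "w permutes {1..n}" "1 \<le> i" "i < n"
  shows "ninv n (adj i \<circ> w) \<le> Suc (ninv n w)"
  using ninv_adj_up[OF assms] ninv_adj_down[OF assms] inv_neq_Suc[OF assms(1), of i]
  by (metis le_refl le_SucI le_Suc_eq linorder_neqE_nat)

lemma ninv_word_perm_le: "set js \<subseteq> {1..<n} \<Longrightarrow> ninv n (word_perm js) \<le> length js"
proof (induction js)
  case (Cons i js)
  then have "ninv n (adj i \<circ> word_perm js) \<le> Suc (ninv n (word_perm js))"
    by (intro ninv_adj_le word_perm_permutes) auto
  moreover have "ninv n (word_perm js) \<le> length js" using Cons by auto
  ultimately show ?case unfolding word_perm_Cons length_Cons by linarith
qed simp

text \<open>Bubble sort: as long as the inverse has a descent at some i, stripping s_i from the left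
  removes one inversion; without descents the permutation is the identity.\<close>

lemma ninv_word_exists:
  assumes "w permutes {1..n}"
  shows "\<exists>js. set js \<subseteq> {1..<n} \<and> word_perm js = w \<and> length js = ninv n w"
  using assms
proof (induction "ninv n w" arbitrary: w rule: less_induct)
  case less
  show ?case
  proof (cases "\<exists>i. 1 \<le> i \<and> i < n \<and> inv w (Suc i) < inv w i")
    case True
    then obtain i where i: "1 \<le> i" "i < n" "inv w (Suc i) < inv w i" by blast
    note down = ninv_adj_down[OF less.prems i]
    obtain js where "set js \<subseteq> {1..<n}" "word_perm js = adj i \<circ> w" "length js = ninv n (adj i \<circ> w)"
      using less.hyps[of "adj i \<circ> w"] down adj_comp_permutes[OF less.prems i(1,2)] by auto
    then show ?thesis using i down by (intro exI[of _ "i # js"]) auto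
  next
    case False
    then have "inv w = id"
      using inv_neq_Suc[OF less.prems]
      by (intro increasing_permutes_id[OF permutes_inv[OF less.prems]]) (metis linorder_neqE_nat)
    then have "w = id" using permutes_inv_inv[OF less.prems] by (metis inv_id)
    then show ?thesis by (intro exI[of _ "[]"]) simp
  qed
qed

lemma perm_length_eq_ninv:
  assumes "w permutes {1..n}"
  shows "perm_length n w = ninv n w"
  unfolding perm_length_def
proof (rule Least_equality)
  show "\<exists>js. set js \<subseteq> {1..<n} \<and> word_perm js = w \<and> length js = ninv n w"
    by (rule ninv_word_exists[OF assms])
next
  fix l assume "\<exists>js. set js \<subseteq> {1..<n} \<and> word_perm js = w \<and> length js = l"
  then show "ninv n w \<le> l" using ninv_word_perm_le by auto
qed

lemma reduced_word_iff:
  "reduced_word n w js \<longleftrightarrow> set js \<subseteq> {1..<n} \<and> word_perm js = w \<and> length js = ninv n w"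
  using perm_length_eq_ninv[OF word_perm_permutes, of js n] by (auto simp: reduced_word_def)

lemma reduced_word_exists: "w permutes {1..n} \<Longrightarrow> \<exists>js. reduced_word n w js"
  using ninv_word_exists by (simp add: reduced_word_iff)

lemma reduced_word_permutes: "reduced_word n w js \<Longrightarrow> w permutes {1..n}"
  using word_perm_permutes by (auto simp: reduced_word_iff)

lemma reduced_word_append:
  assumes "reduced_word n u js" "reduced_word n v ks" "ninv n (u \<circ> v) = ninv n u + ninv n v"
  shows "reduced_word n (u \<circ> v) (js @ ks)"
  using assms by (auto simp: reduced_word_iff word_perm_append)

text \<open>The tail \<open>u\<close> bounds the number of inversions of s_i w by one less than that
  of \<open>w\<close>, so s_i cannot lengthen \<open>w\<close>: the first letter of a reduced word
  is a left descent.\<close>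

lemma reduced_word_ConsD:
  assumes "reduced_word n w (i # u)"
  shows "1 \<le> i" "i < n" "inv w (Suc i) < inv w i" "reduced_word n (adj i \<circ> w) u"
proof -
  have u: "set u \<subseteq> {1..<n}" "word_perm u = adj i \<circ> w" and len: "Suc (length u) = ninv n w"
    and i: "1 \<le> i" "i < n"
    using assms by (auto simp: reduced_word_iff)
  note w = reduced_word_permutes[OF assms]
  have "ninv n (adj i \<circ> w) \<le> length u" using ninv_word_perm_le[OF u(1)] u(2) by simp
  then show d: "inv w (Suc i) < inv w i"
    using len ninv_adj_up[OF w i] inv_neq_Suc[OF w, of i] by fastforce
  show "reduced_word n (adj i \<circ> w) u"
    using ninv_adj_down[OF w i d] u len by (simp add: reduced_word_iff)
qed (use assms in \<open>auto simp: reduced_word_iff\<close>)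

lemma reduced_word_ConsI:
  assumes w: "w permutes {1..n}" "1 \<le> i" "i < n" "inv w (Suc i) < inv w i"
    and u: "reduced_word n (adj i \<circ> w) u"
  shows "reduced_word n w (i # u)"
  using ninv_adj_down[OF w] u w(2,3) by (auto simp: reduced_word_iff)

section \<open>Independence of the reduced word (Matsumoto's theorem)\<close>

definition word_act :: "(nat \<Rightarrow> 'x \<Rightarrow> 'x) \<Rightarrow> nat list \<Rightarrow> 'x \<Rightarrow> 'x"
  where "word_act T js = foldr (\<lambda>i f. T i \<circ> f) js id"

lemma word_act_Nil [simp]: "word_act T [] x = x"
  and word_act_Cons [simp]: "word_act T (i # js) x = T i (word_act T js x)"
  by (simp_all add: word_act_def)

lemma word_act_append: "word_act T (js @ ks) x = word_act T js (word_act T ks x)"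
  by (induction js) auto

lemma word_act_closed:
  assumes "\<And>i x. 1 \<le> i \<Longrightarrow> i < n \<Longrightarrow> x \<in> X \<Longrightarrow> T i x \<in> X"
  shows "set js \<subseteq> {1..<n} \<Longrightarrow> x \<in> X \<Longrightarrow> word_act T js x \<in> X"
  by (induction js) (auto intro!: assms)

text \<open>If the first letters i and j differ, both are left descents of \<open>w\<close>, so
  \<open>w\<close> also has reduced words i j s and j i s (far letters), or i j i s and j i j s
  (adjacent letters), with the same \<open>s\<close>. The induction hypothesis compares each given
  tail with the tail of the new word having the same head, and one relation links the two new words.
  The operators are abstract and act on a set \<open>X\<close> because the relations for the braid
  generators are available on \<open>tpow n\<close>.\<close>

lemma matsumoto:
  assumes closed: "\<And>i x. 1 \<le> i \<Longrightarrow> i < n \<Longrightarrow> x \<in> X \<Longrightarrow> T i x \<in> X"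
    and far: "\<And>i j x. 1 \<le> i \<Longrightarrow> Suc i < j \<Longrightarrow> j < n \<Longrightarrow> x \<in> X \<Longrightarrow> T i (T j x) = T j (T i x)"
    and braid: "\<And>i x. 1 \<le> i \<Longrightarrow> Suc i < n \<Longrightarrow> x \<in> X \<Longrightarrow>
      T i (T (Suc i) (T i x)) = T (Suc i) (T i (T (Suc i) x))"
    and "reduced_word n w js" "reduced_word n w ks" "x \<in> X"
  shows "word_act T js x = word_act T ks x"
  using assms(4-6)
proof (induction "length js" arbitrary: w js ks rule: less_induct)
  case less
  have len: "length js = length ks" using less.prems by (simp add: reduced_word_iff)
  show ?case
  proof (cases js)
    case Nil
    then show ?thesis using len by simp
  next
    case (Cons i u)
    then obtain j v where ks: "ks = j # v" using len by (cases ks) auto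
    have IH: "word_act T a x = word_act T b x"
      if "reduced_word n w' a" "reduced_word n w' b" "Suc (length a) = length js" for w' a b
      using less.hyps[of a w' b] that \<open>x \<in> X\<close> by simp
    have main: "word_act T (i # u) x = word_act T (j # v) x"
      if r: "reduced_word n w (i # u)" "reduced_word n w (j # v)" "length (i # u) = length js" "i < j"
      for i j u v
    proof -
      note w = reduced_word_permutes[OF r(1)]
      note I = reduced_word_ConsD[OF r(1)] and J = reduced_word_ConsD[OF r(2)]
      have lens: "Suc (length u) = length js" "Suc (length v) = length js"
        using r by (simp_all add: reduced_word_iff)
      have piw: "adj i \<circ> w permutes {1..n}" and pjw: "adj j \<circ> w permutes {1..n}"
        using I J w adj_comp_permutes by blast+
      have pjiw: "adj j \<circ> (adj i \<circ> w) permutes {1..n}"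
        and pijw: "adj i \<circ> (adj j \<circ> w) permutes {1..n}"
        using I J piw pjw adj_comp_permutes by blast+
      note invs = inv_adj_comp[OF w] inv_adj_comp[OF piw] inv_adj_comp[OF pjw]
      show ?thesis
      proof (cases "j = Suc i")
        case False
        with \<open>i < j\<close> have ij: "Suc i < j" by simp
        have eq: "adj j \<circ> (adj i \<circ> w) = adj i \<circ> (adj j \<circ> w)"
          using ij by (auto simp: fun_eq_iff transpose_def)
        obtain s where s: "reduced_word n (adj j \<circ> (adj i \<circ> w)) s"
          using reduced_word_exists[OF pjiw] by blast
        have "reduced_word n (adj i \<circ> w) (j # s)"
          using ij J s by (intro reduced_word_ConsI[OF piw]) (auto simp: invs transpose_def)
        then have 1: "word_act T u x = word_act T (j # s) x" using IH I lens by blast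
        have "reduced_word n (adj j \<circ> w) (i # s)"
          using ij I s eq by (intro reduced_word_ConsI[OF pjw]) (auto simp: invs transpose_def)
        then have 2: "word_act T v x = word_act T (i # s) x" using IH J lens by blast
        have "word_act T s x \<in> X"
          using s \<open>x \<in> X\<close> by (intro word_act_closed[of n] closed) (auto simp: reduced_word_iff)
        then show ?thesis using far[of i j] ij I J 1 2 by simp
      next
        case True
        note invs = invs[unfolded True]
        have eq: "adj i \<circ> (adj j \<circ> (adj i \<circ> w)) = adj j \<circ> (adj i \<circ> (adj j \<circ> w))"
          using True by (auto simp: fun_eq_iff transpose_def)
        have "adj i \<circ> (adj j \<circ> (adj i \<circ> w)) permutes {1..n}"
          using I by (intro adj_comp_permutes[OF pjiw]) auto
        then obtain s where s: "reduced_word n (adj i \<circ> (adj j \<circ> (adj i \<circ> w))) s"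
          using reduced_word_exists by blast
        have "reduced_word n (adj j \<circ> (adj i \<circ> w)) (i # s)"
          using True I J s by (intro reduced_word_ConsI[OF pjiw]) (auto simp: invs transpose_def)
        then have "reduced_word n (adj i \<circ> w) (j # i # s)"
          using True I J by (intro reduced_word_ConsI[OF piw]) (auto simp: invs transpose_def)
        then have 1: "word_act T u x = word_act T (j # i # s) x" using IH I lens by blast
        have "reduced_word n (adj i \<circ> (adj j \<circ> w)) (j # s)"
          using True I J s eq by (intro reduced_word_ConsI[OF pijw]) (auto simp: invs transpose_def)
        then have "reduced_word n (adj j \<circ> w) (i # j # s)"
          using True I J by (intro reduced_word_ConsI[OF pjw]) (auto simp: invs transpose_def)
        then have 2: "word_act T v x = word_act T (i # j # s) x" using IH J lens by blast
        have "word_act T s x \<in> X"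
          using s \<open>x \<in> X\<close> by (intro word_act_closed[of n] closed) (auto simp: reduced_word_iff)
        then show ?thesis using braid[of i] True I J 1 2 by simp
      qed
    qed
    show ?thesis
    proof (cases i j rule: linorder_cases)
      case equal
      then show ?thesis
        using IH[of _ u v] reduced_word_ConsD(4) less.prems Cons ks by fastforce
    qed (use main less.prems Cons ks len in fastforce)+
  qed
qed

section \<open>Factorization of permutations through \<open>(1,k)\<close>-shuffles\<close>

text \<open>The permutation 1 x u of a first letter followed by \<open>k\<close> letters. The case 0
  is kept fixed because permuted positions start at 1; if \<open>u\<close> fixes 0, position 1 is
  fixed too.\<close>

definition shift_perm :: "(nat \<Rightarrow> nat) \<Rightarrow> nat \<Rightarrow> nat"
  where "shift_perm u a = (case a of 0 \<Rightarrow> 0 | Suc b \<Rightarrow> Suc (u b))"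

lemma shift_perm_comp: "shift_perm (u \<circ> v) = shift_perm u \<circ> shift_perm v"
  by (auto simp: fun_eq_iff shift_perm_def split: nat.splits)

lemma shift_perm_id [simp]: "shift_perm id = id"
  by (auto simp: fun_eq_iff shift_perm_def split: nat.splits)

lemma inj_shift_perm: "inj shift_perm"
proof
  fix u v assume "shift_perm u = shift_perm v"
  then have "shift_perm u (Suc a) = shift_perm v (Suc a)" for a by simp
  then show "u = v" by (simp add: shift_perm_def fun_eq_iff)
qed

lemma shift_perm_permutes:
  assumes "u permutes {1..k}"
  shows "shift_perm u permutes {1..Suc k}" "shift_perm u 1 = 1"
proof -
  have u0: "u 0 = 0" using permutes_not_in[OF assms, of 0] by simp
  show "shift_perm u 1 = 1" by (simp add: shift_perm_def u0)
  have inverse: "shift_perm u \<circ> shift_perm (inv u) = id" "shift_perm (inv u) \<circ> shift_perm u = id"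
    using permutes_inv_o[OF assms] shift_perm_comp shift_perm_id by metis+
  have "bij (shift_perm u)" using inverse o_bij by blast
  moreover have "shift_perm u x = x" if "x \<notin> {1..Suc k}" for x
    using that permutes_not_in[OF assms, of "x - 1"] by (cases x) (auto simp: shift_perm_def u0)
  ultimately show "shift_perm u permutes {1..Suc k}"
    unfolding permutes_def bij_iff by blast
qed

lemma word_perm_shift: "word_perm (map Suc js) = shift_perm (word_perm js)"
proof (induction js)
  case (Cons i js)
  have "adj (Suc i) = shift_perm (adj i)"
    by (auto simp: fun_eq_iff shift_perm_def transpose_def split: nat.splits)
  with Cons show ?case unfolding list.map word_perm_Cons shift_perm_comp by simp
next
  case Nil
  then show ?case unfolding list.map word_perm_Nil shift_perm_id by (rule refl)
qed

lemma ninv_shift: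
  assumes "u permutes {1..k}"
  shows "ninv (Suc k) (shift_perm u) = ninv k u"
proof -
  have u0: "u 0 = 0" using permutes_not_in[OF assms, of 0] by simp
  have "inversions (Suc k) (shift_perm u) = map_prod Suc Suc ` inversions k u"
  proof (intro set_eqI iffI)
    fix p assume "p \<in> inversions (Suc k) (shift_perm u)"
    then obtain a b where p: "p = (a, b)" "1 \<le> a" "a < b" "b \<le> Suc k" "shift_perm u b < shift_perm u a"
      by (auto simp: inversions_def)
    obtain a' b' where "a = Suc a'" "b = Suc b'" using p by (metis Suc_le_D less_imp_Suc_add One_nat_def)
    with p u0 have "(a', b') \<in> inversions k u" "p = map_prod Suc Suc (a', b')"
      by (auto simp: inversions_def shift_perm_def Suc_le_eq intro: gr0I)
    then show "p \<in> map_prod Suc Suc ` inversions k u" by blast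
  qed (auto simp: inversions_def shift_perm_def)
  then show ?thesis
    by (simp add: ninv_def card_image inj_on_def map_prod_def split: prod.splits)
qed

lemma reduced_word_shift:
  assumes "reduced_word k u js"
  shows "reduced_word (Suc k) (shift_perm u) (map Suc js)"
  using assms ninv_shift[OF reduced_word_permutes[OF assms]]
  by (fastforce simp: reduced_word_iff word_perm_shift)

text \<open>The product s_j ... s_1, i.e. the cycle that sends 1 to j+1 and lowers 2, ..., j+1 by
  one. By \<open>shuffles_1\<close> these are all the (1,k)-shuffles, for j \<le> k.\<close>

primrec cyc :: "nat \<Rightarrow> nat \<Rightarrow> nat" where
  "cyc 0 = id"
| "cyc (Suc j) = adj (Suc j) \<circ> cyc j"

text \<open>After \<open>j\<close> steps the value j+1 sits at position 1, to the left of the value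
  j+2, so multiplying by s_(j+1) creates an inversion. Hence lengths add.\<close>

lemma cyc_comp:
  assumes u: "u permutes {1..n}" "u 1 = 1"
  shows "j < n \<Longrightarrow> cyc j \<circ> u permutes {1..n} \<and> (cyc j \<circ> u) 1 = Suc j \<and> ninv n (cyc j \<circ> u) = j + ninv n u"
proof (induction j)
  case 0
  then show ?case using assms by simp
next
  case (Suc j)
  let ?w = "cyc j \<circ> u"
  have w: "?w permutes {1..n}" "?w 1 = Suc j" "ninv n ?w = j + ninv n u"
    using Suc.IH[OF Suc_lessD[OF Suc.prems]] by blast+
  have p: "adj (Suc j) \<circ> ?w permutes {1..n}" using Suc w by (intro adj_comp_permutes) auto
  have 1: "inv ?w (Suc j) = 1" using w permutes_inverses(2)[OF w(1)] by metis
  have "inv ?w (Suc (Suc j)) \<in> {1..n}"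
    using permutes_in_image[OF permutes_inv[OF w(1)]] Suc.prems by simp
  then have "inv ?w (Suc j) < inv ?w (Suc (Suc j))"
    using 1 inv_neq_Suc[OF w(1), of "Suc j"] by (simp only: atLeastAtMost_iff) linarith
  then have "ninv n (adj (Suc j) \<circ> ?w) = Suc (ninv n ?w)"
    using Suc.prems by (intro ninv_adj_up w) auto
  moreover have "cyc (Suc j) \<circ> u = adj (Suc j) \<circ> ?w" by (simp add: o_assoc)
  moreover have "(adj (Suc j) \<circ> ?w) 1 = Suc (Suc j)" using w(2) by simp
  ultimately show ?case using w(3) p by (simp only: add_Suc simp_thms)
qed

lemma cyc_permutes:
  assumes "j < n"
  shows "cyc j permutes {1..n}" "cyc j 1 = Suc j" "ninv n (cyc j) = j"
  using cyc_comp[of id n j] assms by (simp_all add: permutes_id)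

lemma cyc_less: "2 \<le> a \<Longrightarrow> a < b \<Longrightarrow> cyc j a < cyc j b"
proof (induction j)
  case (Suc j)
  have "cyc j 1 = Suc j" using cyc_permutes[of j "Suc j"] by simp
  moreover have "inj (cyc j)" using permutes_inj cyc_permutes[of j "Suc j"] by blast
  ultimately have "cyc j a \<noteq> Suc j" "cyc j b \<noteq> Suc j" using Suc.prems by (metis injD Suc_1 Suc_n_not_le_n less_le_trans nless_le)+
  then show ?case using Suc by (auto simp: transpose_def)
qed simp

text \<open>The image of 1 recovers \<open>j\<close>, and cancelling \<open>cyc j\<close> recovers
  \<open>u\<close>. Surjectivity is a count: (k+1) k! = (k+1)!.\<close>

lemma bij_cyc_shift:
  "bij_betw (\<lambda>(j, u). cyc j \<circ> shift_perm u) ({..k} \<times> {u. u permutes {1..k}}) {w. w permutes {1..Suc k}}"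
proof -
  let ?f = "\<lambda>(j, u). cyc j \<circ> shift_perm u" and ?D = "{..k} \<times> {u. u permutes {1..k}}"
  have inj: "inj_on ?f ?D"
  proof (rule inj_onI)
    fix p p' assume p: "p \<in> ?D" "p' \<in> ?D" "?f p = ?f p'"
    obtain j u j' u' where ju: "p = (j, u)" "p' = (j', u')" by fastforce
    with p have u: "u permutes {1..k}" "u' permutes {1..k}" and "j < Suc k" "j' < Suc k"
      and eq: "cyc j \<circ> shift_perm u = cyc j' \<circ> shift_perm u'" by auto
    then have j: "Suc j = Suc j'"
      using cyc_comp[OF shift_perm_permutes[OF u(1)], of j] cyc_comp[OF shift_perm_permutes[OF u(2)], of j']
      by simp
    have "inj (cyc j)" using permutes_inj cyc_permutes[of j "Suc j"] by blast
    then have "shift_perm u = shift_perm u'" using eq j by (auto simp: fun_eq_iff dest: injD)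
    then show "p = p'" using j ju inj_shift_perm by (auto dest: injD)
  qed
  have "?f ` ?D \<subseteq> {w. w permutes {1..Suc k}}"
  proof
    fix w assume "w \<in> ?f ` ?D"
    then obtain j u where ju: "j \<le> k" "u permutes {1..k}" "w = cyc j \<circ> shift_perm u" by auto
    then show "w \<in> {w. w permutes {1..Suc k}}"
      using cyc_comp[OF shift_perm_permutes[OF ju(2)], of j] by (simp only: less_Suc_eq_le mem_Collect_eq)
  qed
  moreover have "card (?f ` ?D) = card {w. w permutes {1..Suc k}}"
    using card_image[OF inj] by (simp add: card_permutations card_cartesian_product)
  ultimately have "?f ` ?D = {w. w permutes {1..Suc k}}"
    by (intro card_subset_eq finite_permutations) auto
  with inj show ?thesis by (simp add: bij_betw_def)
qed

text \<open>In the factorization of a shuffle, a descent of \<open>u\<close> would become a descent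
  of \<open>w\<close> beyond position 1, as \<open>cyc j\<close> is increasing from 2 on; so
  \<open>u\<close> has no descent.\<close>

lemma shuffles_1: "shuffles_mn 1 k = cyc ` {..k}"
proof (intro set_eqI iffI)
  fix w assume "w \<in> shuffles_mn 1 k"
  then have w: "w permutes {1..Suc k}" "strict_mono_on {2..Suc k} w"
    by (auto simp: shuffles_mn_def numeral_2_eq_2)
  have "w \<in> (\<lambda>(j, u). cyc j \<circ> shift_perm u) ` ({..k} \<times> {u. u permutes {1..k}})"
    using w(1) bij_betw_imp_surj_on[OF bij_cyc_shift[of k]] by blast
  then obtain j u where ju: "j \<le> k" "u permutes {1..k}" "w = cyc j \<circ> shift_perm u" by auto
  have "u = id"
  proof (rule increasing_permutes_id[OF ju(2)], rule ccontr)
    fix i assume i: "1 \<le> i" "i < k" "\<not> u i < u (Suc i)"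
    have "u i \<noteq> u (Suc i)" using permutes_inj[OF ju(2)] by (metis injD n_not_Suc_n)
    moreover have "u (Suc i) \<in> {1..k}" using permutes_in_image[OF ju(2)] i by simp
    ultimately have "cyc j (Suc (u (Suc i))) < cyc j (Suc (u i))" using i by (intro cyc_less) auto
    moreover have "w (Suc i) < w (Suc (Suc i))"
      using i by (intro strict_mono_onD[OF w(2)]) auto
    ultimately show False by (simp add: ju(3) shift_perm_def)
  qed
  then show "w \<in> cyc ` {..k}" using ju by auto
next
  fix w assume "w \<in> cyc ` {..k}"
  then show "w \<in> shuffles_mn 1 k"
    using cyc_permutes(1)[of _ "Suc k"] cyc_less
    by (auto simp: shuffles_mn_def strict_mono_on_def less_Suc_eq_le)
qed

lemma sum_shuffles_1: "(\<Sum>w\<in>shuffles_mn 1 k. f w) = (\<Sum>j\<le>k. f (cyc j))"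
proof -
  have "inj_on cyc {..k}"
    by (rule inj_onI) (metis atMost_iff cyc_permutes(2) le_imp_less_Suc nat.inject)
  then show ?thesis unfolding shuffles_1 by (simp add: sum.reindex)
qed

lemma sum_permutations_Suc:
  "(\<Sum>w | w permutes {1..Suc k}. f w)
    = (\<Sum>v\<in>shuffles_mn 1 k. \<Sum>u | u permutes {1..k}. f (v \<circ> shift_perm u))"
proof -
  have "(\<Sum>w | w permutes {1..Suc k}. f w)
      = (\<Sum>(j, u)\<in>{..k} \<times> {u. u permutes {1..k}}. f (cyc j \<circ> shift_perm u))"
    using sum.reindex_bij_betw[OF bij_cyc_shift[of k], of f, symmetric]
    by (simp only: split_beta case_prod_unfold)
  then show ?thesis unfolding sum_shuffles_1 by (simp only: sum.cartesian_product)
qed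

lemma sum_permutations_inv:
  "(\<Sum>w | w permutes S. f (inv w)) = (\<Sum>w | w permutes S. f w)"
  by (rule sum.reindex_bij_witness[of _ inv inv]) (auto simp: permutes_inv permutes_inv_inv)

lemma shuffle_1_comp:
  assumes "v \<in> shuffles_mn 1 k" "u permutes {1..k}"
  shows "v \<circ> shift_perm u permutes {1..Suc k}"
    "ninv (Suc k) (v \<circ> shift_perm u) = ninv (Suc k) v + ninv (Suc k) (shift_perm u)"
proof -
  obtain j where j: "v = cyc j" "j < Suc k" using assms(1) unfolding shuffles_1 by auto
  show "v \<circ> shift_perm u permutes {1..Suc k}"
    "ninv (Suc k) (v \<circ> shift_perm u) = ninv (Suc k) v + ninv (Suc k) (shift_perm u)"
    using cyc_comp[OF shift_perm_permutes[OF assms(2)] j(2)] cyc_permutes(3)[OF j(2)] j(1) by metis+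
qed

section \<open>Length generating functions of (1,k)-shuffles and of all permutations\<close>

lemma qnum_eq_sum: "\<nu> \<noteq> 1 \<Longrightarrow> qnum \<nu> n = (\<Sum>j<n. \<nu> ^ j)"
  by (simp add: qnum_def sum_gp_strict)

lemma poincare_shuffles_1:
  assumes "\<nu> \<noteq> 1"
  shows "(\<Sum>w\<in>shuffles_mn 1 k. \<nu> ^ ninv (Suc k) w) = qnum \<nu> (Suc k)"
  unfolding sum_shuffles_1 qnum_eq_sum[OF assms] lessThan_Suc_atMost
  by (intro sum.cong refl) (simp add: cyc_permutes)

text \<open>The Poincare polynomial of the symmetric group. It is multiplicative along the
  factorization into a (1,k)-shuffle and a shifted permutation.\<close>

lemma poincare:
  assumes "\<nu> \<noteq> 1"
  shows "(\<Sum>w | w permutes {1..k}. \<nu> ^ ninv k w) = qfact \<nu> k"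
proof (induction k)
  case 0
  have "{w. w permutes {1..0::nat}} = {id}" by auto
  then show ?case using ninv_id[of 0] by (simp add: qfact_def id_def)
next
  case (Suc k)
  have "(\<Sum>w | w permutes {1..Suc k}. \<nu> ^ ninv (Suc k) w)
    = (\<Sum>v\<in>shuffles_mn 1 k. \<Sum>u | u permutes {1..k}. \<nu> ^ ninv (Suc k) v * \<nu> ^ ninv k u)"
    unfolding sum_permutations_Suc
    by (intro sum.cong refl) (simp add: shuffle_1_comp ninv_shift power_add)
  also have "\<dots> = qnum \<nu> (Suc k) * qfact \<nu> k"
    by (simp only: sum_product[symmetric] poincare_shuffles_1[OF assms] Suc)
  finally show ?case by (simp add: qfact_def mult.commute)
qed

section \<open>Tensor powers in coordinates\<close>

lemma sum_fun_apply: "(\<Sum>a\<in>A. f a) x = (\<Sum>a\<in>A. f a x)"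
  by (induction A rule: infinite_finite_induct) auto

lemma scaleC_fun_apply [simp]: "(c *\<^sub>C f) x = c *\<^sub>C f x"
  by (simp add: scaleC_fun_def)

lemma scaleC_complex [simp]: "c *\<^sub>C (x :: complex) = c * x"
  by (simp add: scaleC_complex_def)

lemma finite_words [simp]: "finite (words k :: 'i::finite list set)"
  using finite_lists_length_eq[of "UNIV :: 'i set" k] by (simp add: words_def)

lemma words_length: "w \<in> words k \<longleftrightarrow> length w = k"
  by (simp add: words_def)

lemma sum_words_add:
  "(\<Sum>w\<in>words (m + n). f w) = (\<Sum>u\<in>words m. \<Sum>v\<in>words n. f (u @ v))"
proof -
  have "bij_betw (\<lambda>(u, v). u @ v) (words m \<times> words n) (words (m + n))"
    by (rule bij_betw_byWitness[where f' = "\<lambda>w. (take m w, drop m w)"]) (auto simp: words_def)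
  from sum.reindex_bij_betw[OF this, of f, symmetric] show ?thesis
    by (simp only: sum.cartesian_product split_beta case_prod_unfold)
qed

lemma tpowD: "t \<in> tpow k \<Longrightarrow> length w \<noteq> k \<Longrightarrow> t w = 0"
  by (simp add: tpow_def)

lemma tpow_0 [simp]: "0 \<in> tpow k"
  and tpow_add: "(x :: ('i, 'a::complex_vector) tensor) \<in> tpow k \<Longrightarrow> y \<in> tpow k \<Longrightarrow> x + y \<in> tpow k"
  and tpow_scaleC: "x \<in> tpow k \<Longrightarrow> c *\<^sub>C x \<in> tpow k"
  by (auto simp: tpow_def)

lemma tpow_sum:
  fixes f :: "'b \<Rightarrow> ('i, 'a::complex_vector) tensor"
  shows "(\<And>a. a \<in> A \<Longrightarrow> f a \<in> tpow k) \<Longrightarrow> (\<Sum>a\<in>A. f a) \<in> tpow k"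
  by (auto simp: tpow_def sum_fun_apply intro: sum.neutral)

lemma ebasis_tpow [simp]: "ebasis u \<in> tpow (length u)"
  by (simp add: ebasis_def tpow_def)

lemma ebasis_words [simp]: "u \<in> words k \<Longrightarrow> ebasis u \<in> tpow k"
  by (auto simp: words_def)

lemma sum_ebasis:
  fixes w :: "'i::finite list"
  assumes "w \<in> words k"
  shows "(\<Sum>u\<in>words k. (ebasis u w :: complex) *\<^sub>C s u) = (s w :: 'a::complex_vector)"
    and "(\<Sum>u\<in>words k. ebasis w u *\<^sub>C s u) = s w"
proof -
  have "(\<Sum>u\<in>words k. (ebasis u w :: complex) *\<^sub>C s u) = (\<Sum>u\<in>words k. if u = w then s u else 0)"
    by (rule sum.cong) (auto simp: ebasis_def scaleC_one)
  then show "(\<Sum>u\<in>words k. (ebasis u w :: complex) *\<^sub>C s u) = s w" using assms by simp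
  have "(\<Sum>u\<in>words k. (ebasis w u :: complex) *\<^sub>C s u) = (\<Sum>u\<in>words k. if u = w then s u else 0)"
    by (rule sum.cong) (auto simp: ebasis_def scaleC_one)
  then show "(\<Sum>u\<in>words k. ebasis w u *\<^sub>C s u) = s w" using assms by simp
qed

lemma tensor_eqI:
  assumes "s \<in> tpow k" "t \<in> tpow k" "\<And>w. length w = k \<Longrightarrow> s w = t w"
  shows "s = t"
  using assms by (metis ext tpowD)

lemma tensor_append_eqI:
  assumes "s \<in> tpow (m + n)" "t \<in> tpow (m + n)"
    and "\<And>u v. length u = m \<Longrightarrow> length v = n \<Longrightarrow> s (u @ v) = t (u @ v)"
  shows "s = t"
proof (rule tensor_eqI[OF assms(1,2)])
  fix w :: "'a list" assume "length w = m + n"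
  then show "s w = t w" using assms(3)[of "take m w" "drop m w"] by simp
qed

lemma ebasis_expand: "t \<in> tpow k \<Longrightarrow> t = (\<Sum>u\<in>words k. t u *\<^sub>C ebasis u)"
  for t :: "('i::finite, complex) tensor"
proof (rule tensor_eqI[of _ k])
  fix w :: "'i list" assume "length w = k"
  then have "(\<Sum>u\<in>words k. t u * ebasis u w) = t w"
    using sum_ebasis(1)[of w k t] by (simp add: words_length mult.commute)
  then show "t w = (\<Sum>u\<in>words k. t u *\<^sub>C ebasis u) w" by (simp add: sum_fun_apply)
qed (auto intro!: tpow_sum tpow_scaleC)

abbreviation lin_tpow :: "nat \<Rightarrow> ('i, 'a::complex_vector) tmap set"
  where "lin_tpow k \<equiv> lin_maps (tpow k) (tpow k)"

lemma lin_tpow_in: "f \<in> lin_tpow k \<Longrightarrow> t \<in> tpow k \<Longrightarrow> f t \<in> tpow k"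
  and lin_tpow_add: "f \<in> lin_tpow k \<Longrightarrow> s \<in> tpow k \<Longrightarrow> t \<in> tpow k \<Longrightarrow> f (s + t) = f s + f t"
  and lin_tpow_scaleC: "f \<in> lin_tpow k \<Longrightarrow> t \<in> tpow k \<Longrightarrow> f (c *\<^sub>C t) = c *\<^sub>C f t"
  by (auto simp: lin_maps_def)

lemma lin_tpow_sum:
  assumes f: "f \<in> lin_tpow k" and g: "\<And>a. a \<in> A \<Longrightarrow> g a \<in> tpow k"
  shows "f (\<Sum>a\<in>A. g a) = (\<Sum>a\<in>A. f (g a))"
proof -
  have "f 0 = 0" using lin_tpow_scaleC[OF f tpow_0, of 0] by simp
  with g show ?thesis
    by (induction A rule: infinite_finite_induct) (auto simp: lin_tpow_add[OF f] tpow_sum)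
qed

lemma lin_tpow_expand:
  fixes f :: "('i::finite, 'a::complex_vector) tmap"
  assumes f: "f \<in> lin_tpow k" and t: "t \<in> tpow k"
  shows "f t = (\<Sum>u\<in>words k. t u *\<^sub>C f (ebasis u))"
proof -
  have "f t = f (\<Sum>u\<in>words k. t u *\<^sub>C ebasis u)" using ebasis_expand[OF t] by simp
  also have "\<dots> = (\<Sum>u\<in>words k. t u *\<^sub>C f (ebasis u))"
    using lin_tpow_scaleC[OF f] by (subst lin_tpow_sum[OF f]) (auto intro: tpow_scaleC)
  finally show ?thesis .
qed

lemma lin_tpow_expand_apply:
  fixes f :: "('i::finite, 'a::complex_vector) tmap"
  shows "f \<in> lin_tpow k \<Longrightarrow> t \<in> tpow k \<Longrightarrow> f t w = (\<Sum>u\<in>words k. t u *\<^sub>C f (ebasis u) w)"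
  by (subst lin_tpow_expand) (simp_all add: sum_fun_apply)

lemma lin_tpow_sum_scaleC:
  assumes "finite A" and f: "\<And>a. a \<in> A \<Longrightarrow> f a \<in> lin_tpow k"
  shows "(\<lambda>t. \<Sum>a\<in>A. c a *\<^sub>C f a t) \<in> lin_tpow k"
  using lin_tpow_in[OF f] lin_tpow_add[OF f] lin_tpow_scaleC[OF f]
  by (auto simp: lin_maps_def sum.distrib scaleC_add_right scaleC_scaleC cvs.scale_sum_right
      mult.commute intro!: tpow_sum tpow_scaleC sum.cong)

lemma lin_tpow_scaled: "f \<in> lin_tpow k \<Longrightarrow> (\<lambda>t. c *\<^sub>C f t) \<in> lin_tpow k"
  using lin_tpow_sum_scaleC[of "{()}" "\<lambda>_. f" k "\<lambda>_. c"] by simp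

lemma lin_tpow_id [simp]: "id \<in> lin_tpow k"
  by (simp add: lin_maps_def)

lemma lin_tpow_comp: "f \<in> lin_tpow k \<Longrightarrow> g \<in> lin_tpow k \<Longrightarrow> (\<lambda>t. f (g t)) \<in> lin_tpow k"
  by (auto simp: lin_maps_def)

lemma slice_left: "t \<in> tpow (m + n) \<Longrightarrow> length u = m \<Longrightarrow> (\<lambda>v. t (u @ v)) \<in> tpow n"
  and slice_right: "t \<in> tpow (m + n) \<Longrightarrow> length v = n \<Longrightarrow> (\<lambda>u. t (u @ v)) \<in> tpow m"
  by (auto simp: tpow_def)

lemma slice_mid: "t \<in> tpow n \<Longrightarrow> length u + m + length z = n \<Longrightarrow> (\<lambda>a. t (u @ a @ z)) \<in> tpow m"
  by (auto simp: tpow_def)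

text \<open>A homogeneous left factor vanishes on prefixes of the wrong length, so a single split
  point contributes and \<open>tprod\<close> becomes the plain tensor product in
  coordinates.\<close>

lemma tprod_append:
  assumes "x \<in> tpow m" "length u = m"
  shows "tprod x y (u @ v) = x u * y v"
proof -
  have "tprod x y (u @ v) = (\<Sum>j\<in>{m}. x (take j (u @ v)) * y (drop j (u @ v)))"
    unfolding tprod_def
  proof (intro sum.mono_neutral_right ballI)
    fix j assume "j \<in> {..length (u @ v)} - {m}"
    then have "length (take j (u @ v)) \<noteq> m" using assms(2) by auto
    from tpowD[OF assms(1) this] show "x (take j (u @ v)) * y (drop j (u @ v)) = 0"
      by (simp only: mult_zero_left)
  qed (use assms in auto)
  then show ?thesis using assms by simp
qed

lemma tprod_tpow:
  assumes "x \<in> tpow m" "y \<in> tpow n"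
  shows "tprod x y \<in> tpow (m + n)"
proof -
  have "x (take j w) * y (drop j w) = 0" if "length w \<noteq> m + n" "j \<le> length w" for w j
  proof -
    have "length (take j w) \<noteq> m \<or> length (drop j w) \<noteq> n" using that by auto
    then show ?thesis using tpowD[OF assms(1)] tpowD[OF assms(2)] by fastforce
  qed
  then show ?thesis by (simp add: tpow_def tprod_def sum.neutral)
qed

lemma map_tensor_append:
  assumes f: "\<And>u. u \<in> words m \<Longrightarrow> f (ebasis u) \<in> tpow m" and u: "length u = m"
  shows "map_tensor m n f g t (u @ v)
    = (\<Sum>u'\<in>words m. \<Sum>v'\<in>words n. t (u' @ v') *\<^sub>C (f (ebasis u') u * g (ebasis v') v))"
  unfolding map_tensor_def using f
  by (simp add: sum_fun_apply tprod_append[OF f u] cong: sum.cong)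

lemma map_tensor_tpow:
  assumes "f \<in> lin_tpow m" "g \<in> lin_tpow n"
  shows "map_tensor m n f g t \<in> tpow (m + n)"
  unfolding map_tensor_def using assms by (intro tpow_sum tpow_scaleC tprod_tpow) (auto simp: lin_tpow_in)

lemma map_tensor_lin:
  assumes "f \<in> lin_tpow m" "g \<in> lin_tpow n"
  shows "map_tensor m n f g \<in> lin_tpow (m + n)"
  unfolding lin_maps_def using map_tensor_tpow[OF assms]
  by (simp add: map_tensor_def sum.distrib scaleC_add_left cvs.scale_sum_right scaleC_scaleC)

text \<open>One map is resolved into its matrix entries while the other is applied to a whole slice
  of \<open>t\<close>. Scalars pass freely, but the entries of \<open>f\<close> stay to the left of
  those of \<open>g\<close>, since the coefficient algebra may be noncommutative.\<close>

lemma map_tensor_left: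
  assumes f: "f \<in> lin_tpow m" and g: "g \<in> lin_tpow n"
    and t: "t \<in> tpow (m + n)" and u: "length u = m"
  shows "map_tensor m n f g t (u @ v) = (\<Sum>u'\<in>words m. f (ebasis u') u * g (\<lambda>v'. t (u' @ v')) v)"
proof -
  have "g (\<lambda>v'. t (u' @ v')) v = (\<Sum>v'\<in>words n. t (u' @ v') *\<^sub>C g (ebasis v') v)"
    if "u' \<in> words m" for u'
    using that by (intro lin_tpow_expand_apply[OF g] slice_left[OF t]) (simp add: words_length)
  then show ?thesis
    by (simp add: map_tensor_append lin_tpow_in[OF f] u sum_distrib_left mult_scaleC_right cong: sum.cong)
qed

lemma map_tensor_right:
  assumes f: "f \<in> lin_tpow m" and g: "g \<in> lin_tpow n"
    and t: "t \<in> tpow (m + n)" and u: "length u = m"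
  shows "map_tensor m n f g t (u @ v) = (\<Sum>v'\<in>words n. f (\<lambda>u'. t (u' @ v')) u * g (ebasis v') v)"
proof -
  have "f (\<lambda>u'. t (u' @ v')) u = (\<Sum>u'\<in>words m. t (u' @ v') *\<^sub>C f (ebasis u') u)"
    if "v' \<in> words n" for v'
    using that by (intro lin_tpow_expand_apply[OF f] slice_right[OF t]) (simp add: words_length)
  then show ?thesis
    by (simp add: map_tensor_append lin_tpow_in[OF f] u sum_distrib_right mult_scaleC_left
        sum.swap[of _ "words m"] cong: sum.cong)
qed

lemma map_tensor_id_left:
  assumes g: "g \<in> lin_tpow n" and t: "t \<in> tpow (m + n)" and u: "length u = m"
  shows "map_tensor m n id g t (u @ v) = g (\<lambda>v'. t (u @ v')) v"
  using sum_ebasis(1)[of u m "\<lambda>u'. g (\<lambda>v'. t (u' @ v')) v"] u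
  by (simp add: map_tensor_left[OF _ g t u] words_length)

lemma map_tensor_id_right:
  assumes f: "f \<in> lin_tpow m" and t: "t \<in> tpow (m + n)" and u: "length u = m" "length v = n"
  shows "map_tensor m n f id t (u @ v) = f (\<lambda>u'. t (u' @ v)) u"
  using sum_ebasis(1)[of v n "\<lambda>v'. f (\<lambda>u'. t (u' @ v')) u"] u
  by (simp add: map_tensor_right[OF f _ t u(1)] words_length mult.commute)

lemma map_tensor_tprod:
  assumes f: "f \<in> lin_tpow m" and g: "g \<in> lin_tpow n" and x: "x \<in> tpow m" and y: "y \<in> tpow n"
  shows "map_tensor m n f g (tprod x y) = tprod (f x) (g y)"
proof (rule tensor_append_eqI)
  fix u v :: "'a list" assume u: "length u = m" "length v = n"
  have "map_tensor m n f g (tprod x y) (u @ v)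
      = (\<Sum>u'\<in>words m. f (ebasis u') u * g (\<lambda>v'. x u' *\<^sub>C y v') v)"
    unfolding map_tensor_left[OF f g tprod_tpow[OF x y] u(1)]
    by (intro sum.cong refl) (simp add: tprod_append[OF x] words_length)
  also have "\<dots> = (\<Sum>u'\<in>words m. (x u' *\<^sub>C f (ebasis u') u) * g y v)"
  proof (rule sum.cong[OF refl])
    fix u'
    have "g (\<lambda>v'. x u' *\<^sub>C y v') = x u' *\<^sub>C g y"
      using lin_tpow_scaleC[OF g y, of "x u'"] by (simp add: scaleC_fun_def)
    then show "f (ebasis u') u * g (\<lambda>v'. x u' *\<^sub>C y v') v = (x u' *\<^sub>C f (ebasis u') u) * g y v"
      by (simp add: mult_scaleC_left mult_scaleC_right)
  qed
  also have "\<dots> = f x u * g y v"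
    by (simp add: lin_tpow_expand_apply[OF f x] sum_distrib_right)
  finally show "map_tensor m n f g (tprod x y) (u @ v) = tprod (f x) (g y) (u @ v)"
    using u by (simp add: tprod_append[OF lin_tpow_in[OF f x]])
qed (use assms in \<open>auto intro: map_tensor_tpow tprod_tpow lin_tpow_in\<close>)

lemma tprod_scaleC_left: "tprod (c *\<^sub>C x) y = c *\<^sub>C tprod x y"
  and tprod_scaleC_right: "tprod x (c *\<^sub>C y) = c *\<^sub>C tprod x y"
  for x y :: "('i, 'a::complex_algebra) tensor"
  by (auto simp: tprod_def fun_eq_iff mult_scaleC_left mult_scaleC_right
      cvs.scale_sum_right)

lemma map_tensor_id_tpow:
  assumes "f \<in> lin_tpow k"
  shows "map_tensor_id k f s \<in> tpow k"
  using lin_tpow_in[OF assms ebasis_words] tpowD[of _ k]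
  by (auto simp: tpow_def map_tensor_id_def intro!: sum.neutral)

lemma map_tensor_id_comp:
  assumes f: "f \<in> lin_tpow k" and g: "g \<in> lin_tpow k"
  shows "map_tensor_id k f (map_tensor_id k g s) = map_tensor_id k (\<lambda>t. f (g t)) s"
proof
  fix w
  have "map_tensor_id k f (map_tensor_id k g s) w
      = (\<Sum>u\<in>words k. \<Sum>v\<in>words k. (g (ebasis v) u *\<^sub>C f (ebasis u) w) *\<^sub>C s v)"
    by (simp add: map_tensor_id_def cvs.scale_sum_right scaleC_scaleC mult.commute)
  also have "\<dots> = (\<Sum>v\<in>words k. f (g (ebasis v)) w *\<^sub>C s v)"
    by (subst sum.swap, rule sum.cong)
      (simp_all add: lin_tpow_expand_apply[OF f lin_tpow_in[OF g]] cvs.scale_sum_left)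
  finally show "map_tensor_id k f (map_tensor_id k g s) w = map_tensor_id k (\<lambda>t. f (g t)) s w"
    by (simp add: map_tensor_id_def)
qed

section \<open>The braid generators\<close>

lemma word_split:
  assumes "length w = n" "1 \<le> i" "i < n"
  obtains u a z where "w = u @ a @ z" "length a = 2" "length u + 2 + length z = n" "i = Suc (length u)"
proof
  show "w = take (i - 1) w @ take 2 (drop (i - 1) w) @ drop 2 (drop (i - 1) w)"
    by (simp only: append_take_drop_id)
qed (use assms in auto)

locale braided_space =
  fixes \<sigma> :: "('i::finite, complex) tmap"
  assumes braiding: "braiding \<sigma>"
begin

abbreviation T :: "nat \<Rightarrow> nat \<Rightarrow> ('i, complex) tmap"
  where "T n i \<equiv> braid_gen \<sigma> n i"

lemma lin_braiding: "\<sigma> \<in> lin_tpow 2"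
  using braiding by (simp add: braiding_def)

lemma braid_gen_lin: "1 \<le> i \<Longrightarrow> i < n \<Longrightarrow> T n i \<in> lin_tpow n"
proof -
  assume i: "1 \<le> i" "i < n"
  then have eq: "2 + (n - i - 1) = n - i + 1" "i - 1 + (n - i + 1) = n" by auto
  show ?thesis
    using map_tensor_lin[OF lin_tpow_id[of "i - 1"] map_tensor_lin[OF lin_braiding lin_tpow_id, of "n - i - 1", unfolded eq]]
    unfolding eq braid_gen_def .
qed

lemmas braid_gen_tpow = lin_tpow_in[OF braid_gen_lin]

text \<open>Freezing the letters outside positions i and i+1 leaves a tensor of degree 2 on which
  the generator is just \<open>\<sigma>\<close>. Relations between generators are checked on such
  slices.\<close>

lemma braid_gen_apply:
  assumes t: "t \<in> tpow n" and n: "length u + 2 + length z = n" and a: "length a = 2"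
    and i: "i = Suc (length u)"
  shows "T n i t (u @ a @ z) = \<sigma> (\<lambda>a. t (u @ a @ z)) a"
proof -
  let ?g = "map_tensor 2 (length z) \<sigma> id"
  have eq: "n - i + 1 = 2 + length z" "i - 1 = length u" "n - i - 1 = length z" using n i by auto
  have tt: "t \<in> tpow (length u + (2 + length z))" using t n by (simp add: add.assoc)
  have "T n i t (u @ a @ z) = ?g (\<lambda>v. t (u @ v)) (a @ z)"
    unfolding braid_gen_def eq
    by (intro map_tensor_id_left map_tensor_lin lin_braiding lin_tpow_id tt refl)
  also have "\<dots> = \<sigma> (\<lambda>a. t (u @ a @ z)) a"
    by (intro map_tensor_id_right lin_braiding slice_left[OF tt] a refl)
  finally show ?thesis .
qed

lemma braid_gen_slice:
  assumes "t \<in> tpow n" and "length u + 2 + length z = n" and "i = Suc (length u)"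
  shows "(\<lambda>a. T n i t (u @ a @ z)) = \<sigma> (\<lambda>a. t (u @ a @ z))"
proof (rule tensor_eqI[of _ 2])
  show "(\<lambda>a. T n i t (u @ a @ z)) \<in> tpow 2" "\<sigma> (\<lambda>a. t (u @ a @ z)) \<in> tpow 2"
    using assms by (auto intro!: slice_mid braid_gen_tpow lin_tpow_in[OF lin_braiding])
qed (use assms braid_gen_apply in auto)

lemma braid_gen_sum:
  assumes t: "t \<in> tpow n" and n: "length u + 2 + length z = n" and a: "length a = 2"
    and i: "i = Suc (length u)"
  shows "T n i t (u @ a @ z) = (\<Sum>b\<in>words 2. t (u @ b @ z) * \<sigma> (ebasis b) a)"
  using n by (subst braid_gen_apply[OF assms], subst lin_tpow_expand_apply[OF lin_braiding slice_mid[OF t]]) auto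

lemma braid_gen_eqI:
  fixes s t :: "('b, 'c::zero) tensor"
  assumes "s \<in> tpow n" "t \<in> tpow n" "1 \<le> i" "i < n"
    and "\<And>u a z. length a = 2 \<Longrightarrow> length u + 2 + length z = n \<Longrightarrow> i = Suc (length u) \<Longrightarrow>
      s (u @ a @ z) = t (u @ a @ z)"
  shows "s = t"
proof (rule tensor_eqI[OF assms(1,2)])
  fix w :: "'b list" assume "length w = n"
  then obtain u a z where "w = u @ a @ z" "length a = 2" "length u + 2 + length z = n" "i = Suc (length u)"
    using word_split assms(3,4) by metis
  then show "s w = t w" using assms(5) by simp
qed

lemma braid_gen_far:
  assumes i: "1 \<le> i" and ij: "Suc i < j" and j: "j < n" and t: "t \<in> tpow n"
  shows "T n i (T n j t) = T n j (T n i t)"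
proof (rule braid_gen_eqI[of _ n _ i])
  have Ti: "T n i s \<in> tpow n" and Tj: "T n j s \<in> tpow n" if "s \<in> tpow n" for s
    using assms that by (auto intro!: braid_gen_tpow)
  then show "T n i (T n j t) \<in> tpow n" "T n j (T n i t) \<in> tpow n" using t by auto
  fix u a z' :: "'i list"
  assume a: "length a = 2" and n: "length u + 2 + length z' = n" and u: "i = Suc (length u)"
  have "length z' = n - i - 1" "1 \<le> j - i - 1" "j - i - 1 < n - i - 1" using n u ij j by auto
  then obtain v b z where z': "z' = v @ b @ z" and b: "length b = 2"
    and "length v + 2 + length z = n - i - 1" "j - i - 1 = Suc (length v)"
    using word_split by metis
  then have j': "j = Suc (length (u @ c @ v))" "length (u @ c @ v) + 2 + length z = n"
    "length u + 2 + length (v @ d @ z) = n" if "length c = 2" "length d = 2" for c d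
    using that u ij j by auto
  have i_eq: "T n i s (u @ a @ v @ b @ z) = (\<Sum>c\<in>words 2. s (u @ c @ v @ b @ z) * \<sigma> (ebasis c) a)"
    if "s \<in> tpow n" "a \<in> words 2" "b \<in> words 2" for s a b
    using braid_gen_sum[of s n u "v @ b @ z" a i] that j' u by (simp add: words_length)
  have j_eq: "T n j s (u @ a @ v @ b @ z) = (\<Sum>d\<in>words 2. s (u @ a @ v @ d @ z) * \<sigma> (ebasis d) b)"
    if "s \<in> tpow n" "a \<in> words 2" "b \<in> words 2" for s a b
    using braid_gen_sum[of s n "u @ a @ v" z b j] that j'(1,2)[of a] by (simp add: words_length)
  have ab: "a \<in> words 2" "b \<in> words 2" using a b by (simp_all add: words_length)
  \<comment> \<open>The two generators touch the disjoint blocks \<open>a\<close> and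
    \<open>b\<close>, so both composites expand to the same double sum in different order.\<close>
  have "T n i (T n j t) (u @ a @ v @ b @ z)
      = (\<Sum>c\<in>words 2. \<Sum>d\<in>words 2. t (u @ c @ v @ d @ z) * \<sigma> (ebasis d) b * \<sigma> (ebasis c) a)"
    using ab t by (simp add: i_eq j_eq Ti Tj sum_distrib_right cong: sum.cong)
  also have "\<dots> = (\<Sum>d\<in>words 2. \<Sum>c\<in>words 2. t (u @ c @ v @ d @ z) * \<sigma> (ebasis c) a * \<sigma> (ebasis d) b)"
    by (subst sum.swap) (simp add: mult_ac)
  also have "\<dots> = T n j (T n i t) (u @ a @ v @ b @ z)"
    using ab t by (simp add: i_eq j_eq Ti Tj sum_distrib_right cong: sum.cong)
  finally show "T n i (T n j t) (u @ a @ z') = T n j (T n i t) (u @ a @ z')" by (simp add: z')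
qed (use assms in auto)

text \<open>With all but three consecutive letters frozen, the two generators become
  \<open>\<sigma>\<close> on the first two and on the last two of these letters, and the claim is
  the braid equation in degree 3.\<close>

lemma braid_gen_braid:
  assumes i: "1 \<le> i" "Suc i < n" and t: "t \<in> tpow n"
  shows "T n i (T n (Suc i) (T n i t)) = T n (Suc i) (T n i (T n (Suc i) t))"
proof (rule tensor_eqI[of _ n])
  let ?T1 = "map_tensor 2 1 \<sigma> id" and ?T2 = "map_tensor 1 2 id \<sigma>"
  have T: "T n i s \<in> tpow n" "T n (Suc i) s \<in> tpow n" if "s \<in> tpow n" for s
    using i that by (auto intro!: braid_gen_tpow)
  then show "T n i (T n (Suc i) (T n i t)) \<in> tpow n" "T n (Suc i) (T n i (T n (Suc i) t)) \<in> tpow n"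
    using t by auto
  fix w :: "'i list" assume "length w = n"
  define u x z where "u = take (i - 1) w" "x = take 3 (drop (i - 1) w)" "z = drop 3 (drop (i - 1) w)"
  have w: "w = u @ x @ z" by (simp only: u_x_z_def append_take_drop_id)
  have len: "length u + 3 + length z = n" "length x = 3" "i = Suc (length u)"
    using \<open>length w = n\<close> i by (auto simp: u_x_z_def)
  let ?s = "\<lambda>t y. t (u @ y @ z)"
  have sl: "?s s \<in> tpow 3" if "s \<in> tpow n" for s :: "('i, complex) tensor"
    using that len by (intro slice_mid[where n = n]) auto
  have three: "(2::nat) + 1 = 3" "(1::nat) + 2 = 3" by auto
  have s1: "?s (T n i s) = ?T1 (?s s)" if s: "s \<in> tpow n" for s
  proof (rule tensor_append_eqI[of _ 2 1])
    show "?s (T n i s) \<in> tpow (2 + 1)"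
      using sl[OF T(1)[OF s]] by (simp only: three)
    show "?T1 (?s s) \<in> tpow (2 + 1)"
      by (intro map_tensor_tpow lin_braiding lin_tpow_id)
    fix a c :: "'i list" assume "length a = 2" "length c = 1"
    then show "?s (T n i s) (a @ c) = ?T1 (?s s) (a @ c)"
      using braid_gen_apply[OF s, of u "c @ z" a i] len
        map_tensor_id_right[OF lin_braiding, of "?s s" 1 a c] sl[OF s] by (simp add: numeral_3_eq_3)
  qed
  have s2: "?s (T n (Suc i) s) = ?T2 (?s s)" if s: "s \<in> tpow n" for s
  proof (rule tensor_append_eqI[of _ 1 2])
    show "?s (T n (Suc i) s) \<in> tpow (1 + 2)"
      using sl[OF T(2)[OF s]] by (simp only: three)
    show "?T2 (?s s) \<in> tpow (1 + 2)"
      by (intro map_tensor_tpow lin_braiding lin_tpow_id)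
    fix c a :: "'i list" assume "length c = 1" "length a = 2"
    then show "?s (T n (Suc i) s) (c @ a) = ?T2 (?s s) (c @ a)"
      using braid_gen_apply[OF s, of "u @ c" z a "Suc i"] len
        map_tensor_id_left[OF lin_braiding, of "?s s" 1 c a] sl[OF s] by (simp add: numeral_3_eq_3)
  qed
  have "?T1 (?T2 (?T1 (?s t))) = ?T2 (?T1 (?T2 (?s t)))"
    using braiding sl[OF t] by (simp add: braiding_def)
  then have "?s (T n i (T n (Suc i) (T n i t))) = ?s (T n (Suc i) (T n i (T n (Suc i) t)))"
    by (simp only: s1 s2 T t)
  then show "T n i (T n (Suc i) (T n i t)) w = T n (Suc i) (T n i (T n (Suc i) t)) w"
    unfolding w by (rule fun_cong)
qed

lemma braid_gen_Cons:
  assumes t: "t \<in> tpow (Suc n)" and i: "1 \<le> i" "i < n" and w: "length w = n"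
  shows "T (Suc n) (Suc i) t (x # w) = T n i (\<lambda>w. t (x # w)) w"
proof -
  obtain u a z where w': "w = u @ a @ z" "length a = 2" "length u + 2 + length z = n" "i = Suc (length u)"
    using word_split[OF w i] .
  have "(\<lambda>w. t (x # w)) \<in> tpow n" using slice_left[of t 1 n "[x]"] t by simp
  then show ?thesis
    using w' braid_gen_apply[OF t, of "x # u" z a "Suc i"] braid_gen_apply[of "\<lambda>w. t (x # w)" n u z a i]
    by simp
qed

lemma braid_gen_tprod_left:
  assumes x: "x \<in> tpow m" and y: "y \<in> tpow n" and i: "1 \<le> i" "i < m"
  shows "T (m + n) i (tprod x y) = tprod (T m i x) y"
proof (rule braid_gen_eqI[of _ "m + n" _ i])
  show "T (m + n) i (tprod x y) \<in> tpow (m + n)" "tprod (T m i x) y \<in> tpow (m + n)"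
    using assms by (auto intro!: braid_gen_tpow tprod_tpow)
  fix u a z' :: "'i list"
  assume a: "length a = 2" and n: "length u + 2 + length z' = m + n" and u: "i = Suc (length u)"
  define z v where "z = take (m - i - 1) z'" "v = drop (m - i - 1) z'"
  then have z': "z' = z @ v" and z: "length u + 2 + length z = m" "length v = n" using n u i by auto
  have xy: "tprod x' y (u @ b @ z @ v) = x' (u @ b @ z) * y v"
    if "x' \<in> tpow m" "b \<in> words 2" for x' b
    using tprod_append[OF that(1), of "u @ b @ z" y v] that z by (simp add: words_length)
  have "T (m + n) i (tprod x y) (u @ a @ z @ v) = (\<Sum>b\<in>words 2. tprod x y (u @ b @ z @ v) * \<sigma> (ebasis b) a)"
    using a z u by (intro braid_gen_sum tprod_tpow x y) auto
  also have "\<dots> = (\<Sum>b\<in>words 2. x (u @ b @ z) * \<sigma> (ebasis b) a) * y v"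
    by (simp add: xy x sum_distrib_left sum_distrib_right mult_ac)
  also have "\<dots> = T m i x (u @ a @ z) * y v"
    using a z u x by (subst braid_gen_sum) auto
  finally show "T (m + n) i (tprod x y) (u @ a @ z') = tprod (T m i x) y (u @ a @ z')"
    using braid_gen_tpow[OF i x] a by (simp add: z' xy words_length)
qed (use i in auto)

lemma braid_gen_tprod_right:
  assumes x: "x \<in> tpow m" and y: "y \<in> tpow n" and i: "1 \<le> i" "i < n"
  shows "T (m + n) (m + i) (tprod x y) = tprod x (T n i y)"
proof (rule braid_gen_eqI[of _ "m + n" _ "m + i"])
  show "T (m + n) (m + i) (tprod x y) \<in> tpow (m + n)" "tprod x (T n i y) \<in> tpow (m + n)"
    using assms by (auto intro!: braid_gen_tpow tprod_tpow)
  fix u' a z :: "'i list"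
  assume a: "length a = 2" and n: "length u' + 2 + length z = m + n" and u': "m + i = Suc (length u')"
  define v u where "v = take m u'" "u = drop m u'"
  then have u'eq: "u' = v @ u" and v: "length v = m" "length u + 2 + length z = n" "i = Suc (length u)"
    using n u' i by auto
  have xy: "tprod x y' (v @ u @ b @ z) = x v * y' (u @ b @ z)" for y' b
    using tprod_append[OF x v(1)] .
  have "T (m + n) (m + i) (tprod x y) ((v @ u) @ a @ z)
      = (\<Sum>b\<in>words 2. tprod x y ((v @ u) @ b @ z) * \<sigma> (ebasis b) a)"
    using a v by (intro braid_gen_sum tprod_tpow x y) auto
  also have "\<dots> = x v * (\<Sum>b\<in>words 2. y (u @ b @ z) * \<sigma> (ebasis b) a)"
    by (simp add: xy sum_distrib_left mult_ac)
  also have "\<dots> = x v * T n i y (u @ a @ z)"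
    using a v y by (subst braid_gen_sum) auto
  finally show "T (m + n) (m + i) (tprod x y) (u' @ a @ z) = tprod x (T n i y) (u' @ a @ z)"
    by (simp add: u'eq xy)
qed (use i in auto)

section \<open>The action of permutations\<close>

abbreviation Tw :: "nat \<Rightarrow> (nat \<Rightarrow> nat) \<Rightarrow> ('i, complex) tmap"
  where "Tw n w \<equiv> braid_perm \<sigma> n w"

text \<open>Matsumoto's theorem removes the choice in \<open>braid_perm\<close>: any convenient
  reduced word may be used.\<close>

lemma braid_perm_eq:
  assumes "reduced_word n w js" "t \<in> tpow n"
  shows "Tw n w t = word_act (T n) js t"
proof -
  have "reduced_word n w (SOME js. reduced_word n w js)" using assms(1) by (rule someI)
  then have "word_act (T n) (SOME js. reduced_word n w js) t = word_act (T n) js t"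
    using assms by (intro matsumoto[where X = "tpow n" and n = n])
      (auto intro!: braid_gen_tpow braid_gen_far braid_gen_braid)
  then show ?thesis by (simp add: braid_perm_def word_act_def)
qed

lemma word_act_lin: "set js \<subseteq> {1..<n} \<Longrightarrow> word_act (T n) js \<in> lin_tpow n"
proof (induction js)
  case Nil
  then show ?case by (simp add: lin_maps_def)
next
  case (Cons i js)
  then show ?case using lin_tpow_comp[OF braid_gen_lin[of i n] Cons.IH] by (simp add: word_act_def comp_def)
qed

lemma braid_perm_lin:
  assumes "w permutes {1..n}"
  shows "Tw n w \<in> lin_tpow n"
proof -
  have "reduced_word n w (SOME js. reduced_word n w js)" using reduced_word_exists[OF assms] by (rule someI_ex)
  then show ?thesis
    using word_act_lin by (auto simp: braid_perm_def word_act_def[symmetric] reduced_word_iff)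
qed

lemma braid_perm_comp:
  assumes "u permutes {1..n}" "v permutes {1..n}" "ninv n (u \<circ> v) = ninv n u + ninv n v" "t \<in> tpow n"
  shows "Tw n (u \<circ> v) t = Tw n u (Tw n v t)"
proof -
  obtain js ks where "reduced_word n u js" "reduced_word n v ks"
    using reduced_word_exists assms(1,2) by blast
  then show ?thesis
    using braid_perm_eq[OF reduced_word_append[OF _ _ assms(3)] assms(4)] braid_perm_eq assms(4)
      lin_tpow_in[OF braid_perm_lin[OF assms(2)] assms(4)] by (simp add: word_act_append)
qed

lemma braid_perm_adj:
  assumes "1 \<le> i" "i < n" "t \<in> tpow n"
  shows "Tw n (adj i) t = T n i t"
proof -
  have "reduced_word n (adj i) [i]" using assms by (simp add: reduced_word_iff ninv_adj)
  from braid_perm_eq[OF this assms(3)] show ?thesis by simp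
qed

text \<open>Shifting all indices of a reduced word of \<open>u\<close> gives a reduced word of 1 x
  u, and every shifted generator leaves the first letter alone.\<close>

lemma braid_perm_Cons:
  assumes u: "u permutes {1..n}" and t: "t \<in> tpow (Suc n)" and w: "length w = n"
  shows "Tw (Suc n) (shift_perm u) t (x # w) = Tw n u (\<lambda>w. t (x # w)) w"
proof -
  have sl: "(\<lambda>w. s (x # w)) \<in> tpow n" if "s \<in> tpow (Suc n)" for s :: "('i, complex) tensor"
    using slice_left[of s 1 n "[x]"] that by simp
  have "(\<lambda>w. word_act (T (Suc n)) (map Suc js) t (x # w)) = word_act (T n) js (\<lambda>w. t (x # w))"
    if "set js \<subseteq> {1..<n}" for js
    using that
  proof (induction js)
    case (Cons i js)
    let ?s = "word_act (T (Suc n)) (map Suc js) t"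
    have i: "1 \<le> i" "i < n" and js: "set js \<subseteq> {1..<n}" using Cons.prems by auto
    have s: "?s \<in> tpow (Suc n)"
      using js by (intro lin_tpow_in[OF word_act_lin] t) auto
    have "(\<lambda>w. T (Suc n) (Suc i) ?s (x # w)) = T n i (\<lambda>w. ?s (x # w))"
      using i s by (intro tensor_eqI[of _ n] sl braid_gen_tpow) (auto simp: braid_gen_Cons)
    then show ?case using Cons.IH[OF js] by simp
  qed simp
  moreover obtain js where js: "reduced_word n u js" using reduced_word_exists[OF u] by blast
  ultimately show ?thesis
    using braid_perm_eq[OF reduced_word_shift[OF js] t] braid_perm_eq[OF js sl[OF t]]
    by (auto simp: reduced_word_iff dest: fun_cong)
qed

end

section \<open>Shuffles\<close>

lemma shuffles_permutes: "w \<in> shuffles_mn m n \<Longrightarrow> w permutes {1..m + n}"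
  by (simp add: shuffles_mn_def)

lemma finite_shuffles [simp]: "finite (shuffles_mn m n)"
  by (rule finite_subset[OF _ finite_permutations[of "{1..m + n}"]]) (auto simp: shuffles_mn_def)

lemma shuffles_less_iff:
  assumes w: "w \<in> shuffles_mn m n" and x: "x \<in> {1..m + n}" and y: "y \<in> {1..m + n}"
    and blk: "(x \<le> m) = (y \<le> m)"
  shows "w x < w y \<longleftrightarrow> x < y"
proof -
  have "strict_mono_on {1..m} w" "strict_mono_on {m + 1..m + n} w"
    using w by (auto simp: shuffles_mn_def)
  moreover have "x \<in> {1..m} \<and> y \<in> {1..m} \<or> x \<in> {m + 1..m + n} \<and> y \<in> {m + 1..m + n}"
    using x y blk by auto
  ultimately show ?thesis by (metis strict_mono_on_less)
qed

text \<open>If the values i and i+1 lie in one block of the shuffle, they occupy neighbouring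
  positions, since a position between them would carry a value strictly between i and i+1. Swapping
  the values is then the same as swapping these positions.\<close>

lemma shuffle_same_block:
  assumes w: "w \<in> shuffles_mn m n" and i: "1 \<le> i" "i < m + n"
    and blk: "(inv w i \<le> m) = (inv w (Suc i) \<le> m)"
  shows "inv w (Suc i) = Suc (inv w i)" "inv w i \<noteq> m" "inv w i \<in> {1..<m + n}"
    "adj i \<circ> w = w \<circ> adj (inv w i)"
proof -
  note p = shuffles_permutes[OF w]
  let ?a = "inv w i" and ?b = "inv w (Suc i)"
  have wi: "w (inv w x) = x" "inv w (w x) = x" for x using permutes_inverses[OF p] by auto
  have rng: "?a \<in> {1..m + n}" "?b \<in> {1..m + n}"
    using i permutes_in_image[OF permutes_inv[OF p]] by auto
  have ab: "?a < ?b" using shuffles_less_iff[OF w rng blk] by (simp add: wi)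
  show b: "?b = Suc ?a"
  proof (rule ccontr)
    assume "?b \<noteq> Suc ?a"
    then have c: "?a < Suc ?a" "Suc ?a < ?b" using ab by auto
    have "Suc ?a \<in> {1..m + n}" "(?a \<le> m) = (Suc ?a \<le> m)" using c rng blk by auto
    then have "w ?a < w (Suc ?a)" "w (Suc ?a) < w ?b"
      using c blk shuffles_less_iff[OF w] rng by blast+
    then show False by (simp add: wi)
  qed
  show "?a \<noteq> m" using blk b by auto
  show "?a \<in> {1..<m + n}" using rng b by auto
  have "adj i (w x) = w (adj ?a x)" for x
  proof -
    consider "x = ?a" | "x = ?b" | "x \<noteq> ?a" "x \<noteq> ?b" by blast
    then show ?thesis
    proof cases
      case 3
      then have "w x \<noteq> i" "w x \<noteq> Suc i" using wi by metis+
      with 3 show ?thesis unfolding b by simp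
    next
      case 1
      then show ?thesis using wi(1)[of "Suc i"] by (simp add: wi b)
    next
      case 2
      then show ?thesis using wi(1)[of "Suc i"] by (simp add: wi b)
    qed
  qed
  then show "adj i \<circ> w = w \<circ> adj ?a" by (auto simp: fun_eq_iff)
qed

text \<open>Exchanging i and i+1 alters the order only of the two positions carrying these values,
  and monotonicity never compares positions in different blocks.\<close>

lemma shuffle_other_block:
  assumes w: "w \<in> shuffles_mn m n" and i: "1 \<le> i" "i < m + n"
    and blk: "(inv w i \<le> m) \<noteq> (inv w (Suc i) \<le> m)"
  shows "adj i \<circ> w \<in> shuffles_mn m n"
proof -
  note p = shuffles_permutes[OF w]
  have wi: "w (inv w x) = x" "inv w (w x) = x" for x using permutes_inverses[OF p] by auto
  have "adj i (w x) < adj i (w y)"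
    if xy: "x \<in> {1..m + n}" "y \<in> {1..m + n}" "(x \<le> m) = (y \<le> m)" "x < y" for x y
  proof -
    have "w x < w y" using shuffles_less_iff[OF w xy(1-3)] xy(4) by simp
    moreover have "\<not> (w x = i \<and> w y = Suc i)" using blk xy(3) wi by metis
    ultimately show ?thesis by (auto simp: transpose_def)
  qed
  then show ?thesis using adj_comp_permutes[OF p i] by (auto simp: shuffles_mn_def strict_mono_on_def)
qed

section \<open>The exterior powers of a braiding of Hecke type\<close>

lemma ebasis_append: "ebasis (u @ v) = tprod (ebasis u) (ebasis v)"
proof (rule tensor_append_eqI[of _ "length u" "length v"])
  show "ebasis (u @ v) \<in> tpow (length u + length v)" using ebasis_tpow[of "u @ v"] by simp
  show "tprod (ebasis u) (ebasis v) \<in> tpow (length u + length v)"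
    by (intro tprod_tpow ebasis_tpow)
  fix u' v' :: "'a list" assume len: "length u' = length u" "length v' = length v"
  show "ebasis (u @ v) (u' @ v') = tprod (ebasis u) (ebasis v) (u' @ v')"
    unfolding tprod_append[OF ebasis_tpow len(1)] using len by (simp add: ebasis_def)
qed

locale hecke_space = braided_space \<sigma> for \<sigma> :: "('i::finite, complex) tmap" +
  fixes q :: complex
  assumes q: "q \<noteq> 0" and not_root: "\<And>n. n \<ge> 1 \<Longrightarrow> (q powi -2) ^ n \<noteq> 1" and hecke: "hecke_type q \<sigma>"
begin

definition \<epsilon> :: complex where "\<epsilon> = - inverse q"
abbreviation \<nu> :: complex where "\<nu> \<equiv> q powi -2"

lemma nu: "\<nu> = \<epsilon>\<^sup>2"
  by (simp add: \<epsilon>_def power_int_minus power_inverse)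

lemma minus_power_int: "(- q) powi (- int l) = \<epsilon> ^ l"
  by (simp add: \<epsilon>_def power_int_minus power_int_of_nat flip: power_inverse)

lemma nu_neq_1: "\<nu> \<noteq> 1"
  using not_root[of 1] by simp

lemma qnum_1 [simp]: "qnum \<nu> (Suc 0) = 1"
  using nu_neq_1 by (simp add: qnum_def)

lemma qfact_neq_0 [simp]: "qfact \<nu> n \<noteq> 0"
  using nu_neq_1 not_root by (force simp: qfact_def qnum_def)

lemma qfact_0 [simp]: "qfact \<nu> 0 = 1"
  and qfact_1 [simp]: "qfact \<nu> (Suc 0) = 1"
  by (simp_all add: qfact_def)

lemma qfact_Suc: "qfact \<nu> (Suc n) = qnum \<nu> (Suc n) * qfact \<nu> n"
  by (simp add: qfact_def)

text \<open>Since 1/\<epsilon> = -q, the operator 1 + \<epsilon> T is \<epsilon> (T - q), and the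
  Hecke relation says that T + 1/q = T - \<epsilon> kills its image.\<close>

lemma braid_gen_hecke:
  assumes i: "1 \<le> i" "i < n" and t: "t \<in> tpow n"
  shows "T n i (t + \<epsilon> *\<^sub>C T n i t) = \<epsilon> *\<^sub>C (t + \<epsilon> *\<^sub>C T n i t)"
proof (rule braid_gen_eqI[of _ n _ i])
  show "T n i (t + \<epsilon> *\<^sub>C T n i t) \<in> tpow n" "\<epsilon> *\<^sub>C (t + \<epsilon> *\<^sub>C T n i t) \<in> tpow n"
    using assms by (auto intro!: braid_gen_tpow tpow_add tpow_scaleC)
  fix u a z :: "'i list"
  assume a: "length a = 2" and n: "length u + 2 + length z = n" and u: "i = Suc (length u)"
  let ?s = "\<lambda>t a. t (u @ a @ z)"
  have Tt: "T n i t \<in> tpow n" using braid_gen_tpow[OF i t] .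
  have s: "?s t \<in> tpow 2" using slice_mid[OF t] n by simp
  have S: "\<sigma> (?s t) \<in> tpow 2" using lin_tpow_in[OF lin_braiding s] .
  let ?r = "\<sigma> (?s t) + inverse q *\<^sub>C ?s t"
  have "\<sigma> ?r - q *\<^sub>C ?r = 0" using hecke s by (simp add: hecke_type_def Let_def)
  moreover have "\<sigma> ?r = \<sigma> (\<sigma> (?s t)) + inverse q *\<^sub>C \<sigma> (?s t)"
    using lin_tpow_add[OF lin_braiding S tpow_scaleC[OF s]] lin_tpow_scaleC[OF lin_braiding s] by simp
  ultimately have "(\<sigma> (\<sigma> (?s t)) + inverse q *\<^sub>C \<sigma> (?s t) - q *\<^sub>C ?r) a = 0" by simp
  then have "\<sigma> (\<sigma> (?s t)) a + inverse q * \<sigma> (?s t) a = q * \<sigma> (?s t) a + t (u @ a @ z)"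
    using q by (simp add: distrib_left)
  then have h': "\<sigma> (\<sigma> (?s t)) a = q * \<sigma> (?s t) a + t (u @ a @ z) + \<epsilon> * \<sigma> (?s t) a"
    by (simp add: \<epsilon>_def algebra_simps)
  have e: "\<epsilon> * (q * x) = - x" for x using q by (simp add: \<epsilon>_def)
  have Tlin: "T n i (t + \<epsilon> *\<^sub>C T n i t) = T n i t + \<epsilon> *\<^sub>C T n i (T n i t)"
    unfolding lin_tpow_add[OF braid_gen_lin[OF i] t tpow_scaleC[OF Tt]]
      lin_tpow_scaleC[OF braid_gen_lin[OF i] Tt] by (rule refl)
  have "T n i t (u @ a @ z) = \<sigma> (?s t) a" using braid_gen_apply[OF t n a u] .
  moreover have "T n i (T n i t) (u @ a @ z) = \<sigma> (\<sigma> (?s t)) a"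
    using braid_gen_apply[OF Tt n a u] by (simp add: braid_gen_slice[OF t n u])
  ultimately show "T n i (t + \<epsilon> *\<^sub>C T n i t) (u @ a @ z) = (\<epsilon> *\<^sub>C (t + \<epsilon> *\<^sub>C T n i t)) (u @ a @ z)"
    using h' e unfolding Tlin by (simp add: distrib_left)
qed (use i in auto)

text \<open>The eigenvector description of the exterior power, proved equivalent in
  \<open>qext_eq_alt\<close> for positive degree. In degrees 0 and 1 there are no generators and the
  condition is vacuous.\<close>

definition alt :: "nat \<Rightarrow> ('i, complex) tensor set"
  where "alt n = {t \<in> tpow n. \<forall>i. 1 \<le> i \<and> i < n \<longrightarrow> T n i t = \<epsilon> *\<^sub>C t}"

lemma alt_tpow: "t \<in> alt n \<Longrightarrow> t \<in> tpow n"
  by (simp add: alt_def)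

lemma alt_add: "s \<in> alt n \<Longrightarrow> t \<in> alt n \<Longrightarrow> s + t \<in> alt n"
  using lin_tpow_add[OF braid_gen_lin] by (auto simp: alt_def scaleC_add_right tpow_add)

lemma alt_scaleC: "t \<in> alt n \<Longrightarrow> c *\<^sub>C t \<in> alt n"
  using lin_tpow_scaleC[OF braid_gen_lin] by (auto simp: alt_def scaleC_scaleC tpow_scaleC mult.commute)

lemma braid_perm_alt:
  assumes w: "w permutes {1..n}" and t: "t \<in> alt n"
  shows "Tw n w t = \<epsilon> ^ ninv n w *\<^sub>C t"
proof -
  obtain js where js: "reduced_word n w js" using reduced_word_exists[OF w] by blast
  have "word_act (T n) ks t = \<epsilon> ^ length ks *\<^sub>C t" if "set ks \<subseteq> {1..<n}" for ks
    using that
  proof (induction ks)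
    case (Cons i ks)
    then have "T n i (\<epsilon> ^ length ks *\<^sub>C t) = \<epsilon> ^ length ks *\<^sub>C (\<epsilon> *\<^sub>C t)"
      using t lin_tpow_scaleC[OF braid_gen_lin] by (auto simp: alt_def)
    moreover have "word_act (T n) ks t = \<epsilon> ^ length ks *\<^sub>C t"
      by (rule Cons.IH) (use Cons.prems in simp)
    ultimately show ?case
      by (simp only: word_act_Cons scaleC_scaleC length_Cons power_Suc mult.commute)
  qed (simp add: scaleC_one)
  then show ?thesis using js braid_perm_eq[OF js alt_tpow[OF t]] by (simp add: reduced_word_iff)
qed

lemma sh_plus_eq:
  "sh_plus q \<sigma> m n t = (qfact \<nu> m * qfact \<nu> n / qfact \<nu> (m + n)) *\<^sub>C
    (\<Sum>w\<in>shuffles_mn m n. \<epsilon> ^ ninv (m + n) w *\<^sub>C Tw (m + n) w t)"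
  by (simp add: sh_plus_def minus_power_int perm_length_eq_ninv[OF shuffles_permutes])

lemma sh_minus_eq:
  "sh_minus q \<sigma> m n t = (qfact \<nu> m * qfact \<nu> n / qfact \<nu> (m + n)) *\<^sub>C
    (\<Sum>w\<in>shuffles_mn m n. \<epsilon> ^ ninv (m + n) w *\<^sub>C Tw (m + n) (inv w) t)"
  by (simp add: sh_minus_def minus_power_int perm_length_eq_ninv[OF shuffles_permutes])

lemma antisymmetrizer_eq:
  "antisymmetrizer q \<sigma> n t =
    (1 / qfact \<nu> n) *\<^sub>C (\<Sum>w | w permutes {1..n}. \<epsilon> ^ ninv n w *\<^sub>C Tw n w t)"
  by (simp add: antisymmetrizer_def minus_power_int perm_length_eq_ninv)

lemma sh_plus_lin: "sh_plus q \<sigma> m n \<in> lin_tpow (m + n)"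
  unfolding sh_plus_eq[abs_def]
  by (intro lin_tpow_scaled lin_tpow_sum_scaleC braid_perm_lin shuffles_permutes) auto

lemma sh_minus_lin: "sh_minus q \<sigma> m n \<in> lin_tpow (m + n)"
  unfolding sh_minus_eq[abs_def]
  by (intro lin_tpow_scaled lin_tpow_sum_scaleC braid_perm_lin permutes_inv shuffles_permutes) auto

lemma antisymmetrizer_lin: "antisymmetrizer q \<sigma> n \<in> lin_tpow n"
  unfolding antisymmetrizer_eq[abs_def]
  by (intro lin_tpow_scaled lin_tpow_sum_scaleC braid_perm_lin finite_permutations) auto

lemma braid_perm_adj_comp:
  assumes w: "w permutes {1..n}" and i: "1 \<le> i" "i < n" and up: "inv w i < inv w (Suc i)"
    and t: "t \<in> tpow n"
  shows "Tw n (adj i \<circ> w) t = T n i (Tw n w t)"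
proof -
  have "Tw n (adj i \<circ> w) t = Tw n (adj i) (Tw n w t)"
    using ninv_adj[OF i] ninv_adj_up[OF w i up] by (intro braid_perm_comp adj_permutes i w t) simp
  then show ?thesis using braid_perm_adj[OF i lin_tpow_in[OF braid_perm_lin[OF w] t]] by simp
qed

text \<open>Left multiplication by \<open>s\<^sub>i\<close> either stays among the shuffles \<open>w\<close>, where the Hecke relation applies
  to the pair \<open>w\<close>, \<open>s\<^sub>i w\<close>, or turns into right multiplication by some \<open>s\<^sub>a\<close> with \<open>a \<noteq> m\<close>.\<close>

lemma sh_plus_alt:
  assumes x: "x \<in> tpow (m + n)"
    and eigen: "\<And>j. 1 \<le> j \<Longrightarrow> j < m + n \<Longrightarrow> j \<noteq> m \<Longrightarrow> T (m + n) j x = \<epsilon> *\<^sub>C x"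
  shows "sh_plus q \<sigma> m n x \<in> alt (m + n)"
proof -
  let ?S = "shuffles_mn m n" and ?N = "m + n"
  define y where "y w = \<epsilon> ^ ninv ?N w *\<^sub>C Tw ?N w x" for w
  have yN: "y w \<in> tpow ?N" if "w \<in> ?S" for w
    unfolding y_def using that x by (intro tpow_scaleC lin_tpow_in[OF braid_perm_lin] shuffles_permutes)
  have main: "T ?N i (\<Sum>w\<in>?S. y w) = \<epsilon> *\<^sub>C (\<Sum>w\<in>?S. y w)" if i: "1 \<le> i" "i < ?N" for i
  proof -
    note Tlin = braid_gen_lin[OF i]
    \<comment> \<open>\<open>E\<close> collects the shuffles with i and i+1 in one block. Left
      multiplication by s_i exchanges \<open>D\<close> and \<open>U\<close>, with \<open>D\<close>
      holding the shorter member of each pair; summing a pair yields (1 + \<epsilon> T_i) applied to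
      the term of \<open>D\<close>.\<close>
    define E D U where "E = {w \<in> ?S. (inv w i \<le> m) = (inv w (Suc i) \<le> m)}"
      "D = {w \<in> ?S. (inv w i \<le> m) \<noteq> (inv w (Suc i) \<le> m) \<and> inv w i < inv w (Suc i)}"
      "U = {w \<in> ?S. (inv w i \<le> m) \<noteq> (inv w (Suc i) \<le> m) \<and> inv w (Suc i) < inv w i}"
    have fin: "finite E" "finite D" "finite U" by (auto simp: E_D_U_def)
    have S: "?S = E \<union> (D \<union> U)" and disj: "E \<inter> (D \<union> U) = {}" "D \<inter> U = {}"
      using inv_neq_Suc[OF shuffles_permutes] by (auto simp: E_D_U_def)
    have adj: "adj i \<circ> w \<in> ?S" "inv (adj i \<circ> w) i = inv w (Suc i)" "inv (adj i \<circ> w) (Suc i) = inv w i"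
      if "w \<in> D \<union> U" for w
      using that shuffle_other_block[OF _ i] inv_adj_comp[OF shuffles_permutes]
      by (auto simp: E_D_U_def)
    have "(\<Sum>w\<in>U. y w) = (\<Sum>w\<in>D. y (adj i \<circ> w))"
    proof (rule sum.reindex_bij_witness[of _ "\<lambda>w. adj i \<circ> w" "\<lambda>w. adj i \<circ> w"])
      show "adj i \<circ> w \<in> D" if "w \<in> U" for w using adj[of w] that unfolding E_D_U_def by auto
      show "adj i \<circ> w \<in> U" if "w \<in> D" for w using adj[of w] that unfolding E_D_U_def by auto
    qed (simp_all only: adj_adj_comp)
    also have "\<dots> = (\<Sum>w\<in>D. \<epsilon> *\<^sub>C T ?N i (y w))"
    proof (rule sum.cong[OF refl])
      fix w assume "w \<in> D"
      then have w: "w permutes {1..?N}" and up: "inv w i < inv w (Suc i)"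
        using shuffles_permutes by (auto simp: E_D_U_def)
      show "y (adj i \<circ> w) = \<epsilon> *\<^sub>C T ?N i (y w)"
        unfolding y_def ninv_adj_up[OF w i up] braid_perm_adj_comp[OF w i up x]
        using lin_tpow_scaleC[OF Tlin lin_tpow_in[OF braid_perm_lin[OF w] x]]
        by (simp add: scaleC_scaleC)
    qed
    finally have sum: "(\<Sum>w\<in>?S. y w) = (\<Sum>w\<in>E. y w) + (\<Sum>w\<in>D. y w + \<epsilon> *\<^sub>C T ?N i (y w))"
      unfolding S using fin disj by (simp add: sum.union_disjoint sum.distrib)
    have TE: "T ?N i (y w) = \<epsilon> *\<^sub>C y w" if "w \<in> E" for w
    proof -
      have w: "w \<in> ?S" and p: "w permutes {1..?N}" and blk: "(inv w i \<le> m) = (inv w (Suc i) \<le> m)"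
        using that shuffles_permutes by (auto simp: E_D_U_def)
      define a where "a = inv w i"
      note sb = shuffle_same_block[OF w i blk, folded a_def]
      have up: "inv w i < inv w (Suc i)" using sb(1) a_def by simp
      have a: "1 \<le> a" "a < ?N" using sb(3) by auto
      have "Tw ?N (w \<circ> adj a) x = Tw ?N w (Tw ?N (adj a) x)"
        using ninv_adj[OF a] ninv_adj_up[OF p i up] sb(4) by (intro braid_perm_comp p adj_permutes a x) simp
      also have "\<dots> = \<epsilon> *\<^sub>C Tw ?N w x"
        using braid_perm_adj[OF a x] eigen[OF a sb(2)] lin_tpow_scaleC[OF braid_perm_lin[OF p] x] by simp
      finally have "T ?N i (Tw ?N w x) = \<epsilon> *\<^sub>C Tw ?N w x"
        using braid_perm_adj_comp[OF p i up x] sb(4) by simp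
      then show ?thesis
        using lin_tpow_scaleC[OF Tlin lin_tpow_in[OF braid_perm_lin[OF p] x]]
        by (simp add: y_def scaleC_scaleC mult.commute)
    qed
    have ED: "w \<in> ?S" if "w \<in> E \<or> w \<in> D" for w using that by (auto simp: E_D_U_def)
    have TyN: "y w + \<epsilon> *\<^sub>C T ?N i (y w) \<in> tpow ?N" if "w \<in> D" for w
      using that ED yN by (intro tpow_add tpow_scaleC braid_gen_tpow i) auto
    have "T ?N i (\<Sum>w\<in>?S. y w)
        = T ?N i (\<Sum>w\<in>E. y w) + T ?N i (\<Sum>w\<in>D. y w + \<epsilon> *\<^sub>C T ?N i (y w))"
      unfolding sum using ED yN TyN by (intro lin_tpow_add[OF Tlin] tpow_sum) auto
    also have "\<dots> = (\<Sum>w\<in>E. \<epsilon> *\<^sub>C y w) + (\<Sum>w\<in>D. \<epsilon> *\<^sub>C (y w + \<epsilon> *\<^sub>C T ?N i (y w)))"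
      using ED yN TyN by (simp add: lin_tpow_sum[OF Tlin] TE braid_gen_hecke[OF i])
    also have "\<dots> = \<epsilon> *\<^sub>C (\<Sum>w\<in>?S. y w)"
      unfolding sum by (simp only: cvs.scale_sum_right scaleC_add_right)
    finally show ?thesis .
  qed
  have "(\<Sum>w\<in>?S. y w) \<in> alt ?N"
    unfolding alt_def using main yN by (auto intro: tpow_sum)
  then show ?thesis unfolding sh_plus_eq y_def[symmetric] by (rule alt_scaleC)
qed

lemma qext_alt: "in_qext q \<sigma> n x \<Longrightarrow> x \<in> alt n"
proof (induction rule: in_qext.induct)
  case unit
  then show ?case using ebasis_tpow[of "[]"] by (simp add: alt_def)
next
  case (gen v)
  then show ?case by (simp add: alt_def)
next
  case (mult m x n y)
  note x = alt_tpow[OF mult.IH(1)] and y = alt_tpow[OF mult.IH(2)]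
  \<comment> \<open>Only the generator at position \<open>m\<close> straddles the two factors. All
    others act inside \<open>x\<close> or inside \<open>y\<close>, which supplies the eigenvector
    hypothesis of \<open>sh_plus_alt\<close>.\<close>
  have "T (m + n) j (tprod x y) = \<epsilon> *\<^sub>C tprod x y" if j: "1 \<le> j" "j < m + n" "j \<noteq> m" for j
  proof (cases "j < m")
    case True
    then have "T (m + n) j (tprod x y) = tprod (\<epsilon> *\<^sub>C x) y"
      using braid_gen_tprod_left[OF x y j(1)] mult.IH(1) j(1) by (simp add: alt_def)
    then show ?thesis by (simp only: tprod_scaleC_left)
  next
    case False
    then have k: "1 \<le> j - m" "j - m < n" "m + (j - m) = j" using j by auto
    then have "T (m + n) j (tprod x y) = tprod x (\<epsilon> *\<^sub>C y)"
      using braid_gen_tprod_right[OF x y k(1,2)] mult.IH(2) by (simp add: alt_def)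
    then show ?thesis by (simp only: tprod_scaleC_right)
  qed
  then show ?case unfolding qshuffle_def by (intro sh_plus_alt tprod_tpow x y)
next
  case (add k x y)
  then show ?case by (intro alt_add)
next
  case (scale k x c)
  then show ?case by (intro alt_scaleC)
qed

section \<open>Antisymmetrizers as projections onto the exterior powers\<close>

lemma antisymmetrizer_alt:
  assumes "z \<in> alt n"
  shows "antisymmetrizer q \<sigma> n z = z"
proof -
  have "(\<Sum>w | w permutes {1..n}. \<epsilon> ^ ninv n w *\<^sub>C Tw n w z) = (\<Sum>w | w permutes {1..n}. \<nu> ^ ninv n w) *\<^sub>C z"
    unfolding cvs.scale_sum_left
  proof (intro sum.cong refl)
    fix w assume "w \<in> {w. w permutes {1..n}}"
    then have "w permutes {1..n}" by simp
    then show "\<epsilon> ^ ninv n w *\<^sub>C Tw n w z = \<nu> ^ ninv n w *\<^sub>C z"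
      by (simp add: braid_perm_alt[OF _ assms] scaleC_scaleC nu power2_eq_square power_mult_distrib)
  qed
  then show ?thesis
    unfolding antisymmetrizer_eq poincare[OF nu_neq_1] by (simp add: scaleC_scaleC scaleC_one)
qed

text \<open>On an eigenvector the shuffle sum is the scalar \<open>qnum \<nu> (Suc n)\<close>, the
  generating function of the (1,n)-shuffles, and this is the inverse of the normalizing
  factor.\<close>

lemma sh_plus_1_alt:
  assumes "z \<in> alt (1 + n)"
  shows "sh_plus q \<sigma> 1 n z = z"
proof -
  have "(\<Sum>w\<in>shuffles_mn 1 n. \<epsilon> ^ ninv (1 + n) w *\<^sub>C Tw (1 + n) w z)
      = (\<Sum>w\<in>shuffles_mn 1 n. \<nu> ^ ninv (Suc n) w) *\<^sub>C z"
    unfolding cvs.scale_sum_left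
  proof (intro sum.cong refl)
    fix w assume w: "w \<in> shuffles_mn 1 n"
    show "\<epsilon> ^ ninv (1 + n) w *\<^sub>C Tw (1 + n) w z = \<nu> ^ ninv (Suc n) w *\<^sub>C z"
      unfolding braid_perm_alt[OF shuffles_permutes[OF w] assms]
      by (simp add: scaleC_scaleC nu power2_eq_square power_mult_distrib)
  qed
  then show ?thesis
    unfolding sh_plus_eq poincare_shuffles_1[OF nu_neq_1]
    using qfact_neq_0[of "Suc n"] by (simp add: qfact_Suc scaleC_scaleC scaleC_one)
qed

lemma map_tensor_antisymmetrizer:
  assumes t: "t \<in> tpow (1 + n)"
  shows "map_tensor 1 n id (antisymmetrizer q \<sigma> n) t
    = (1 / qfact \<nu> n) *\<^sub>C (\<Sum>u | u permutes {1..n}. \<epsilon> ^ ninv n u *\<^sub>C Tw (1 + n) (shift_perm u) t)"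
    (is "_ = ?r")
proof (rule tensor_append_eqI[of _ 1 n])
  have sp: "shift_perm u permutes {1..1 + n}" if "u permutes {1..n}" for u
    using shift_perm_permutes[OF that] by simp
  show "map_tensor 1 n id (antisymmetrizer q \<sigma> n) t \<in> tpow (1 + n)"
    by (intro map_tensor_tpow lin_tpow_id antisymmetrizer_lin)
  show "?r \<in> tpow (1 + n)"
    using t sp by (intro tpow_scaleC tpow_sum lin_tpow_in[OF braid_perm_lin]) auto
  fix u v :: "'i list" assume u: "length u = 1" and v: "length v = n"
  then obtain x where x: "u = [x]" by (cases u) auto
  have "map_tensor 1 n id (antisymmetrizer q \<sigma> n) t (u @ v) = antisymmetrizer q \<sigma> n (\<lambda>v. t (x # v)) v"
    using map_tensor_id_left[OF antisymmetrizer_lin t u] by (simp add: x)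
  also have "\<dots> = (1 / qfact \<nu> n) * (\<Sum>u | u permutes {1..n}. \<epsilon> ^ ninv n u * Tw n u (\<lambda>v. t (x # v)) v)"
    by (simp add: antisymmetrizer_eq sum_fun_apply)
  also have "\<dots> = ?r (u @ v)"
  proof -
    have "(\<Sum>u | u permutes {1..n}. \<epsilon> ^ ninv n u * Tw n u (\<lambda>v. t (x # v)) v)
        = (\<Sum>u | u permutes {1..n}. \<epsilon> ^ ninv n u * Tw (1 + n) (shift_perm u) t (x # v))"
      using t v by (intro sum.cong refl) (simp add: braid_perm_Cons)
    then show ?thesis by (simp add: sum_fun_apply x)
  qed
  finally show "map_tensor 1 n id (antisymmetrizer q \<sigma> n) t (u @ v) = ?r (u @ v)" .
qed

text \<open>Every permutation is uniquely v (1 x u) with v a (1,n)-shuffle. Lengths add, so both the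
  weight and sigma_w factor, and the factorials of degree \<open>n\<close> cancel.\<close>

lemma antisymmetrizer_Suc_left:
  assumes t: "t \<in> tpow (1 + n)"
  shows "antisymmetrizer q \<sigma> (1 + n) t = sh_plus q \<sigma> 1 n (map_tensor 1 n id (antisymmetrizer q \<sigma> n) t)"
proof -
  have sp: "shift_perm u permutes {1..1 + n}" if "u permutes {1..n}" for u
    using shift_perm_permutes[OF that] by simp
  have St: "Tw (1 + n) (shift_perm u) t \<in> tpow (1 + n)" if "u permutes {1..n}" for u
    using lin_tpow_in[OF braid_perm_lin[OF sp[OF that]] t] .
  let ?A = "\<lambda>v u. \<epsilon> ^ ninv (1 + n) v *\<^sub>C \<epsilon> ^ ninv n u *\<^sub>C Tw (1 + n) v (Tw (1 + n) (shift_perm u) t)"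
  have "(\<Sum>w | w permutes {1..1 + n}. \<epsilon> ^ ninv (1 + n) w *\<^sub>C Tw (1 + n) w t)
      = (\<Sum>v\<in>shuffles_mn 1 n. \<Sum>u | u permutes {1..n}. ?A v u)"
    unfolding plus_1_eq_Suc sum_permutations_Suc
  proof (intro sum.cong refl)
    fix v u assume v: "v \<in> shuffles_mn 1 n" and "u \<in> {u. u permutes {1..n}}"
    then have u: "u permutes {1..n}" by simp
    note c = shuffle_1_comp(2)[OF v u]
    have "Tw (Suc n) (v \<circ> shift_perm u) t = Tw (Suc n) v (Tw (Suc n) (shift_perm u) t)"
      using shuffles_permutes[OF v] sp[OF u] t c by (intro braid_perm_comp) auto
    then show "\<epsilon> ^ ninv (Suc n) (v \<circ> shift_perm u) *\<^sub>C Tw (Suc n) (v \<circ> shift_perm u) t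
        = \<epsilon> ^ ninv (Suc n) v *\<^sub>C \<epsilon> ^ ninv n u *\<^sub>C Tw (Suc n) v (Tw (Suc n) (shift_perm u) t)"
      unfolding c ninv_shift[OF u] by (simp add: power_add scaleC_scaleC)
  qed
  moreover have "Tw (1 + n) v (map_tensor 1 n id (antisymmetrizer q \<sigma> n) t)
      = (1 / qfact \<nu> n) *\<^sub>C (\<Sum>u | u permutes {1..n}. \<epsilon> ^ ninv n u *\<^sub>C Tw (1 + n) v (Tw (1 + n) (shift_perm u) t))"
    if "v \<in> shuffles_mn 1 n" for v
  proof -
    note L = braid_perm_lin[OF shuffles_permutes[OF that]]
    let ?g = "\<lambda>u. \<epsilon> ^ ninv n u *\<^sub>C Tw (1 + n) (shift_perm u) t"
    have g: "?g u \<in> tpow (1 + n)" if "u \<in> {u. u permutes {1..n}}" for u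
      using St that by (intro tpow_scaleC) auto
    have "Tw (1 + n) v (\<Sum>u | u permutes {1..n}. ?g u) = (\<Sum>u | u permutes {1..n}. Tw (1 + n) v (?g u))"
      by (rule lin_tpow_sum[OF L g])
    also have "\<dots> = (\<Sum>u | u permutes {1..n}. \<epsilon> ^ ninv n u *\<^sub>C Tw (1 + n) v (Tw (1 + n) (shift_perm u) t))"
      using St by (intro sum.cong refl lin_tpow_scaleC[OF L]) auto
    finally have sum: "Tw (1 + n) v (\<Sum>u | u permutes {1..n}. ?g u) = \<dots>" .
    have "(\<Sum>u | u permutes {1..n}. ?g u) \<in> tpow (1 + n)" by (rule tpow_sum[OF g])
    from lin_tpow_scaleC[OF L this] show ?thesis
      unfolding map_tensor_antisymmetrizer[OF t] sum .
  qed
  then have "(\<Sum>v\<in>shuffles_mn 1 n. \<epsilon> ^ ninv (1 + n) v *\<^sub>C Tw (1 + n) v (map_tensor 1 n id (antisymmetrizer q \<sigma> n) t))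
      = (1 / qfact \<nu> n) *\<^sub>C (\<Sum>v\<in>shuffles_mn 1 n. \<Sum>u | u permutes {1..n}. ?A v u)"
    unfolding cvs.scale_sum_right
    by (intro sum.cong refl) (simp only: cvs.scale_sum_right scaleC_scaleC mult_ac)
  ultimately show ?thesis
    unfolding antisymmetrizer_eq sh_plus_eq by (simp add: scaleC_scaleC)
qed

text \<open>The mirror image: summing over inverses writes each permutation as (1 x u) v^(-1).
  Inversion preserves length, so lengths still add.\<close>

lemma antisymmetrizer_Suc_right:
  assumes t: "t \<in> tpow (1 + n)"
  shows "antisymmetrizer q \<sigma> (1 + n) t = map_tensor 1 n id (antisymmetrizer q \<sigma> n) (sh_minus q \<sigma> 1 n t)"
proof -
  have sp: "shift_perm u permutes {1..1 + n}" if "u permutes {1..n}" for u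
    using shift_perm_permutes[OF that] by simp
  have inv_shift: "inv (shift_perm u) = shift_perm (inv u)" if "u permutes {1..n}" for u
  proof (rule inv_equality)
    fix x show "shift_perm (inv u) (shift_perm u x) = x"
      using permutes_inv_o(2)[OF that] shift_perm_comp[of "inv u" u] by (metis comp_apply id_apply shift_perm_id)
    show "shift_perm u (shift_perm (inv u) x) = x"
      using permutes_inv_o(1)[OF that] shift_perm_comp[of u "inv u"] by (metis comp_apply id_apply shift_perm_id)
  qed
  let ?A = "\<lambda>v u. \<epsilon> ^ ninv (1 + n) v *\<^sub>C \<epsilon> ^ ninv n u *\<^sub>C Tw (1 + n) (shift_perm u) (Tw (1 + n) (inv v) t)"
  let ?f = "\<lambda>w. \<epsilon> ^ ninv (1 + n) w *\<^sub>C Tw (1 + n) w t"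
  have f_inv: "?f (inv (v \<circ> shift_perm (inv u))) = ?A v u"
    if v: "v \<in> shuffles_mn 1 n" and u: "u permutes {1..n}" for v u
  proof -
    note iu = permutes_inv[OF u] and vp = shuffles_permutes[OF v]
    have vsp: "v \<circ> shift_perm (inv u) permutes {1..1 + n}" using shuffle_1_comp(1)[OF v iu] by simp
    have eq: "inv (v \<circ> shift_perm (inv u)) = shift_perm u \<circ> inv v"
      using o_inv_distrib[OF permutes_bij[OF vp] permutes_bij[OF sp[OF iu]]] inv_shift[OF iu]
        permutes_inv_inv[OF u] by simp
    have len: "ninv (1 + n) (shift_perm u \<circ> inv v) = ninv (1 + n) (shift_perm u) + ninv (1 + n) (inv v)"
      using ninv_inv[OF vsp] shuffle_1_comp(2)[OF v iu] ninv_inv[OF vp] ninv_shift[OF iu] ninv_inv[OF u]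
        ninv_shift[OF u] unfolding eq by simp
    have "Tw (1 + n) (shift_perm u \<circ> inv v) t = Tw (1 + n) (shift_perm u) (Tw (1 + n) (inv v) t)"
      by (intro braid_perm_comp sp u permutes_inv vp len t)
    then show ?thesis
      unfolding eq len ninv_inv[OF vp] using ninv_shift[OF u]
      by (simp add: power_add scaleC_scaleC mult.commute)
  qed
  have "(\<Sum>w | w permutes {1..1 + n}. ?f w) = (\<Sum>w | w permutes {1..1 + n}. ?f (inv w))"
    using sum_permutations_inv[of ?f] by simp
  also have "\<dots> = (\<Sum>v\<in>shuffles_mn 1 n. \<Sum>u | u permutes {1..n}. ?f (inv (v \<circ> shift_perm u)))"
    using sum_permutations_Suc[of "\<lambda>w. ?f (inv w)" n] by simp
  also have "\<dots> = (\<Sum>v\<in>shuffles_mn 1 n. \<Sum>u | u permutes {1..n}. ?f (inv (v \<circ> shift_perm (inv u))))"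
    by (simp only: sum_permutations_inv[where f = "\<lambda>u. ?f (inv (v \<circ> shift_perm u))" for v])
  also have "\<dots> = (\<Sum>v\<in>shuffles_mn 1 n. \<Sum>u | u permutes {1..n}. ?A v u)"
    by (intro sum.cong refl f_inv) auto
  finally have main: "(\<Sum>w | w permutes {1..1 + n}. ?f w) = (\<Sum>v\<in>shuffles_mn 1 n. \<Sum>u | u permutes {1..n}. ?A v u)" .
  have it: "Tw (1 + n) (inv v) t \<in> tpow (1 + n)" if "v \<in> shuffles_mn 1 n" for v
    using t lin_tpow_in[OF braid_perm_lin[OF permutes_inv[OF shuffles_permutes[OF that]]]] by simp
  have "Tw (1 + n) (shift_perm u) (sh_minus q \<sigma> 1 n t) = (qfact \<nu> 1 * qfact \<nu> n / qfact \<nu> (1 + n)) *\<^sub>C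
      (\<Sum>v\<in>shuffles_mn 1 n. \<epsilon> ^ ninv (1 + n) v *\<^sub>C Tw (1 + n) (shift_perm u) (Tw (1 + n) (inv v) t))"
    if u: "u permutes {1..n}" for u
  proof -
    note L = braid_perm_lin[OF sp[OF u]]
    let ?g = "\<lambda>v. \<epsilon> ^ ninv (1 + n) v *\<^sub>C Tw (1 + n) (inv v) t"
    have g: "?g v \<in> tpow (1 + n)" if "v \<in> shuffles_mn 1 n" for v
      using it that by (intro tpow_scaleC) auto
    have "Tw (1 + n) (shift_perm u) (\<Sum>v\<in>shuffles_mn 1 n. ?g v) = (\<Sum>v\<in>shuffles_mn 1 n. Tw (1 + n) (shift_perm u) (?g v))"
      by (rule lin_tpow_sum[OF L g])
    also have "\<dots> = (\<Sum>v\<in>shuffles_mn 1 n. \<epsilon> ^ ninv (1 + n) v *\<^sub>C Tw (1 + n) (shift_perm u) (Tw (1 + n) (inv v) t))"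
      using it by (intro sum.cong refl lin_tpow_scaleC[OF L]) auto
    finally have sum: "Tw (1 + n) (shift_perm u) (\<Sum>v\<in>shuffles_mn 1 n. ?g v) = \<dots>" .
    have "(\<Sum>v\<in>shuffles_mn 1 n. ?g v) \<in> tpow (1 + n)" by (rule tpow_sum[OF g])
    from lin_tpow_scaleC[OF L this] show ?thesis unfolding sh_minus_eq sum .
  qed
  then have "(\<Sum>u | u permutes {1..n}. \<epsilon> ^ ninv n u *\<^sub>C Tw (1 + n) (shift_perm u) (sh_minus q \<sigma> 1 n t))
      = (qfact \<nu> 1 * qfact \<nu> n / qfact \<nu> (1 + n)) *\<^sub>C (\<Sum>u | u permutes {1..n}. \<Sum>v\<in>shuffles_mn 1 n. ?A v u)"
    unfolding cvs.scale_sum_right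
    by (intro sum.cong refl) (simp only: mem_Collect_eq cvs.scale_sum_right scaleC_scaleC mult_ac)
  then have "map_tensor 1 n id (antisymmetrizer q \<sigma> n) (sh_minus q \<sigma> 1 n t)
      = (1 / qfact \<nu> (1 + n)) *\<^sub>C (\<Sum>u | u permutes {1..n}. \<Sum>v\<in>shuffles_mn 1 n. ?A v u)"
    unfolding map_tensor_antisymmetrizer[OF lin_tpow_in[OF sh_minus_lin t]] by (simp add: scaleC_scaleC)
  also have "\<dots> = antisymmetrizer q \<sigma> (1 + n) t"
    unfolding antisymmetrizer_eq main by (subst sum.swap) (rule refl)
  finally show ?thesis by (rule sym)
qed

lemma antisymmetrizer_1: "t \<in> tpow 1 \<Longrightarrow> antisymmetrizer q \<sigma> 1 t = t"
  by (rule antisymmetrizer_alt) (simp add: alt_def)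

text \<open>The inductive definition has no clause for 0, which the empty sum requires; it is
  obtained by scaling some element of the same degree by 0.\<close>

lemma qext_sum:
  assumes "n \<ge> 1" "\<And>a. a \<in> A \<Longrightarrow> f a \<in> qext q \<sigma> n"
  shows "(\<Sum>a\<in>A. f a) \<in> qext q \<sigma> n"
proof -
  have "qext q \<sigma> n \<noteq> {}"
  proof (cases n)
    case (Suc k)
    have *: "\<exists>x. in_qext q \<sigma> (Suc k) x" for k
    proof (induction k)
      case 0
      then show ?case using in_qext.gen[of 0] by auto
    next
      case (Suc k)
      then show ?case using in_qext.mult[OF in_qext.gen[OF tpow_0]] by fastforce
    qed
    show ?thesis using *[of k] Suc by (auto simp: qext_def)
  qed (use assms in simp)
  then have "0 \<in> qext q \<sigma> n" using in_qext.scale[of q \<sigma> n _ 0] by (auto simp: qext_def)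
  with assms(2) show ?thesis
    by (induction A rule: infinite_finite_induct) (auto simp: qext_def intro: in_qext.add)
qed

text \<open>By \<open>antisymmetrizer_Suc_left\<close>, antisymmetrizing the word x v gives the
  quantum shuffle product of the generator x with the antisymmetrization of v, so induction keeps
  the image inside the subalgebra.\<close>

lemma antisymmetrizer_qext:
  assumes "t \<in> tpow (Suc n)"
  shows "antisymmetrizer q \<sigma> (Suc n) t \<in> qext q \<sigma> (Suc n)"
  using assms
proof (induction n arbitrary: t)
  case 0
  then show ?case using antisymmetrizer_1[of t] in_qext.gen[of t] by (simp add: qext_def)
next
  case (Suc n)
  note L = antisymmetrizer_lin[of "1 + Suc n"]
  have "antisymmetrizer q \<sigma> (1 + Suc n) (ebasis w) \<in> qext q \<sigma> (1 + Suc n)" if w: "w \<in> words (1 + Suc n)" for w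
  proof -
    obtain x v where v: "w = [x] @ v" "length v = Suc n" using w by (cases w) (auto simp: words_length)
    have xv: "ebasis [x] \<in> tpow 1" "ebasis v \<in> tpow (Suc n)"
      using ebasis_tpow[of v] ebasis_tpow[of "[x]"] v by simp_all
    have "antisymmetrizer q \<sigma> (1 + Suc n) (ebasis w)
        = sh_plus q \<sigma> 1 (Suc n) (map_tensor 1 (Suc n) id (antisymmetrizer q \<sigma> (Suc n)) (tprod (ebasis [x]) (ebasis v)))"
      using antisymmetrizer_Suc_left[OF ebasis_words[OF w]] by (simp only: v ebasis_append)
    also have "\<dots> = qshuffle q \<sigma> 1 (Suc n) (ebasis [x]) (antisymmetrizer q \<sigma> (Suc n) (ebasis v))"
      by (simp only: qshuffle_def map_tensor_tprod[OF lin_tpow_id antisymmetrizer_lin xv] id_apply)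
    finally have "antisymmetrizer q \<sigma> (1 + Suc n) (ebasis w)
        = qshuffle q \<sigma> 1 (Suc n) (ebasis [x]) (antisymmetrizer q \<sigma> (Suc n) (ebasis v))" .
    moreover have "antisymmetrizer q \<sigma> (Suc n) (ebasis v) \<in> qext q \<sigma> (Suc n)"
      using Suc.IH[of "ebasis v"] ebasis_tpow[of v] v by simp
    ultimately show ?thesis
      using in_qext.mult[OF in_qext.gen[of "ebasis [x]"]] ebasis_tpow[of "[x]"] by (auto simp: qext_def)
  qed
  then have "(\<Sum>w\<in>words (1 + Suc n). t w *\<^sub>C antisymmetrizer q \<sigma> (1 + Suc n) (ebasis w)) \<in> qext q \<sigma> (1 + Suc n)"
    by (intro qext_sum) (auto simp: qext_def intro: in_qext.scale)
  then show ?case using lin_tpow_expand[OF L] Suc.prems by simp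
qed

text \<open>A circle of inclusions: \<open>alt n\<close> consists of fixed points of the
  antisymmetrizer, whose image lies in the generated subalgebra, which in turn lies in
  \<open>alt n\<close>.\<close>

lemma qext_eq_alt: "n \<ge> 1 \<Longrightarrow> qext q \<sigma> n = alt n"
  using antisymmetrizer_qext[of _ "n - 1"] antisymmetrizer_alt[of _ n] alt_tpow[of _ n] qext_alt
  by (force simp: qext_def)

text \<open>For the chosen preimage \<open>s\<close> of \<open>z\<close>, the first antisymmetrizer
  acts trivially in degree 1, so the coproduct is (id x A^(n)) Sh^- s = A^(1+n) s = z. The witness
  \<open>t\<close> = Sh^- s is returned because it places \<open>z\<close> in the span of products
  of exterior powers.\<close>

lemma qcoprod_alt:
  assumes z: "z \<in> alt (1 + n)"
  obtains t where "t \<in> tpow (1 + n)" "qcoprod q \<sigma> 1 n z = map_tensor 1 n id (antisymmetrizer q \<sigma> n) t"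
    "qcoprod q \<sigma> 1 n z = z"
proof -
  define s where "s = inv_into (tpow (1 + n)) (antisymmetrizer q \<sigma> (1 + n)) z"
  have "z \<in> antisymmetrizer q \<sigma> (1 + n) ` tpow (1 + n)"
    using antisymmetrizer_alt[OF z] alt_tpow[OF z] by (metis image_eqI)
  then have s: "s \<in> tpow (1 + n)" "antisymmetrizer q \<sigma> (1 + n) s = z"
    unfolding s_def by (rule inv_into_into, rule f_inv_into_f)
  let ?t = "sh_minus q \<sigma> 1 n s"
  have "qcoprod q \<sigma> 1 n z = map_tensor 1 n id (antisymmetrizer q \<sigma> n) ?t"
    unfolding qcoprod_def s_def[symmetric] map_tensor_def
    by (intro sum.cong refl) (simp add: antisymmetrizer_1[OF ebasis_words, simplified] words_length)
  then show ?thesis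
    using that[of ?t] lin_tpow_in[OF sh_minus_lin s(1)] antisymmetrizer_Suc_right[OF s(1)] s(2) by simp
qed

end

section \<open>Cross powers of compatible maps\<close>

lemma cross_pow_lin:
  assumes "F \<in> lin_tpow 1" "k \<ge> 1"
  shows "cross_pow F k \<in> lin_tpow k"
  using assms(2)
proof (induction k)
  case (Suc k)
  then show ?case using map_tensor_lin[OF assms(1), of "cross_pow F k" k] assms(1) by (cases "k = 0") auto
qed simp

lemma cross_pow_2: "cross_pow F 2 = map_tensor 1 1 F F"
  by (simp add: numeral_2_eq_2)

lemma cross_pow_append:
  assumes F: "F \<in> lin_tpow 1" and k: "k \<ge> 1" and t: "t \<in> tpow (1 + k)" and u: "length u = 1"
  shows "cross_pow F (1 + k) t (u @ w)
    = (\<Sum>u'\<in>words 1. F (ebasis u') u * cross_pow F k (\<lambda>v. t (u' @ v)) w)"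
  using map_tensor_left[OF F cross_pow_lin[OF F k] t u] k by simp

text \<open>Cross powers are built one factor at a time, whereas compatibility concerns two;
  associativity of the coefficient algebra regroups the first two factors into a cross
  square.\<close>

lemma cross_pow_append_2:
  assumes F: "F \<in> lin_tpow 1" and k: "k \<ge> 1" and t: "t \<in> tpow (2 + k)" and a: "length a = 2"
  shows "cross_pow F (2 + k) t (a @ w)
    = (\<Sum>b\<in>words 2. cross_pow F 2 (ebasis b) a * cross_pow F k (\<lambda>v. t (b @ v)) w)"
proof -
  define x y where "x = take 1 a" "y = drop 1 a"
  have xy: "a = x @ y" "length x = 1" "length y = 1" using a by (auto simp: x_y_def)
  have two: "2 + k = 1 + (1 + k)" "(2::nat) = 1 + 1" by simp_all
  note t' = t[unfolded two(1)]
  have F2: "cross_pow F 2 (ebasis (x' @ y')) a = F (ebasis x') x * F (ebasis y') y"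
    if "x' \<in> words 1" "y' \<in> words 1" for x' y'
    unfolding cross_pow_2 ebasis_append map_tensor_tprod[OF F F ebasis_words[OF that(1)] ebasis_words[OF that(2)]] xy(1)
    by (rule tprod_append[OF lin_tpow_in[OF F ebasis_words[OF that(1)]] xy(2)])
  have "cross_pow F (2 + k) t (a @ w)
      = (\<Sum>x'\<in>words 1. F (ebasis x') x * cross_pow F (1 + k) (\<lambda>v. t (x' @ v)) (y @ w))"
    unfolding two(1) using cross_pow_append[OF F _ t' xy(2), of "y @ w"] by (simp add: xy(1))
  also have "\<dots> = (\<Sum>x'\<in>words 1. F (ebasis x') x *
      (\<Sum>y'\<in>words 1. F (ebasis y') y * cross_pow F k (\<lambda>v. t (x' @ y' @ v)) w))"
  proof (intro sum.cong refl)
    fix x' :: "'a list" assume "x' \<in> words 1"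
    then show "F (ebasis x') x * cross_pow F (1 + k) (\<lambda>v. t (x' @ v)) (y @ w) = F (ebasis x') x *
      (\<Sum>y'\<in>words 1. F (ebasis y') y * cross_pow F k (\<lambda>v. t (x' @ y' @ v)) w)"
      using cross_pow_append[OF F k slice_left[OF t'] xy(3), of x' w] by (simp add: words_length)
  qed
  also have "\<dots> = (\<Sum>x'\<in>words 1. \<Sum>y'\<in>words 1.
      cross_pow F 2 (ebasis (x' @ y')) a * cross_pow F k (\<lambda>v. t ((x' @ y') @ v)) w)"
    unfolding sum_distrib_left by (intro sum.cong refl) (simp only: F2 append_assoc mult.assoc)
  also have "\<dots> = (\<Sum>b\<in>words (1 + 1). cross_pow F 2 (ebasis b) a * cross_pow F k (\<lambda>v. t (b @ v)) w)"
    by (rule sum_words_add[symmetric])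
  finally show ?thesis by (simp only: one_add_one)
qed

lemma map_tensor_id_lin:
  assumes "f \<in> lin_tpow k"
  shows "map_tensor_id k f (s + s') = map_tensor_id k f s + map_tensor_id k f s'"
    "map_tensor_id k f (c *\<^sub>C s) = c *\<^sub>C map_tensor_id k f s"
  by (auto simp: map_tensor_id_def fun_eq_iff scaleC_add_right sum.distrib cvs.scale_sum_right scaleC_scaleC mult.commute)

context braided_space
begin

lemma map_tensor_id_braid_gen:
  assumes n: "length u + 2 + length z = n" and a: "length a = 2" and i: "i = Suc (length u)"
  shows "map_tensor_id n (T n i) s (u @ a @ z) = (\<Sum>b\<in>words 2. \<sigma> (ebasis b) a *\<^sub>C s (u @ b @ z))"
proof -
  have "map_tensor_id n (T n i) s (u @ a @ z)
      = (\<Sum>v\<in>words n. \<Sum>b\<in>words 2. \<sigma> (ebasis b) a *\<^sub>C ebasis v (u @ b @ z) *\<^sub>C s v)"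
    unfolding map_tensor_id_def
    by (intro sum.cong refl)
      (simp add: braid_gen_sum[OF ebasis_words n a i] cvs.scale_sum_left scaleC_scaleC mult.commute)
  also have "\<dots> = (\<Sum>b\<in>words 2. \<sigma> (ebasis b) a *\<^sub>C (\<Sum>v\<in>words n. ebasis v (u @ b @ z) *\<^sub>C s v))"
    by (subst sum.swap) (simp only: cvs.scale_sum_right)
  also have "\<dots> = (\<Sum>b\<in>words 2. \<sigma> (ebasis b) a *\<^sub>C s (u @ b @ z))"
    using n by (intro sum.cong refl arg_cong[where f = "\<lambda>x. _ *\<^sub>C x"] sum_ebasis(1)) (simp add: words_length)
  finally show ?thesis .
qed

lemma braid_gen_slice_left:
  assumes t: "t \<in> tpow (1 + n)" and i: "1 \<le> i" "i < n" and u: "length u = 1"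
  shows "(\<lambda>v. T (1 + n) (1 + i) t (u @ v)) = T n i (\<lambda>v. t (u @ v))"
proof (rule tensor_eqI[of _ n])
  have "T (1 + n) (1 + i) t \<in> tpow (1 + n)" using t i by (intro braid_gen_tpow) auto
  then show "(\<lambda>v. T (1 + n) (1 + i) t (u @ v)) \<in> tpow n" by (rule slice_left[OF _ u])
  show "T n i (\<lambda>v. t (u @ v)) \<in> tpow n" using slice_left[OF t u] i by (intro braid_gen_tpow)
  fix v :: "'i list" assume v: "length v = n"
  obtain x where "u = [x]" using u by (cases u) auto
  then show "T (1 + n) (1 + i) t (u @ v) = T n i (\<lambda>v. t (u @ v)) v"
    using braid_gen_Cons[of t n i v x] t i v by simp
qed

lemma map_tensor_id_braid_gen_left:
  assumes i: "1 \<le> i" "i < n" and u: "length u = 1" and w: "length w = n"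
  shows "map_tensor_id (1 + n) (T (1 + n) (1 + i)) s (u @ w) = map_tensor_id n (T n i) (\<lambda>v. s (u @ v)) w"
proof -
  obtain v a z where "w = v @ a @ z" "length a = 2" "length v + 2 + length z = n" "i = Suc (length v)"
    using word_split[OF w i] .
  then show ?thesis
    using map_tensor_id_braid_gen[of "u @ v" z "1 + n" a "1 + i" s]
      map_tensor_id_braid_gen[of v z n a i "\<lambda>v. s (u @ v)"] u by simp
qed

lemma compatible_lin: "F \<in> compatible_maps \<sigma> \<Longrightarrow> F \<in> lin_tpow 1"
  by (simp add: compatible_maps_def)

lemma braid_gen_2:
  assumes "t \<in> tpow 2"
  shows "T 2 1 t = \<sigma> t"
  using braid_gen_slice[of t 2 "[]" "[]" 1] assms by simp

text \<open>After regrouping, the first generator meets only the cross square on the first two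
  letters, where compatibility applies.\<close>

lemma cross_pow_braid_gen_1:
  assumes F: "F \<in> compatible_maps \<sigma>" and t: "t \<in> tpow (2 + k)"
  shows "cross_pow F (2 + k) (T (2 + k) 1 t) = map_tensor_id (2 + k) (T (2 + k) 1) (cross_pow F (2 + k) t)"
\<comment> \<open>Degree 2 is separate because \<open>cross_pow F 0\<close> is a dummy value and
  cannot serve as the second factor.\<close>
proof (cases "k = 0")
  case True
  have "map_tensor_id 2 (T 2 1) s = map_tensor_id 2 \<sigma> s" for s :: "('i, 'a) tensor"
    unfolding map_tensor_id_def by (intro ext sum.cong refl) (simp only: braid_gen_2 ebasis_words)
  then show ?thesis using F t True braid_gen_2[of t] by (simp add: compatible_maps_def)
next
  case False
  then have k: "k \<ge> 1" by simp
  note FL = compatible_lin[OF F]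
  have F2L: "cross_pow F 2 \<in> lin_tpow 2" by (rule cross_pow_lin[OF FL]) simp
  have FnL: "cross_pow F (2 + k) \<in> lin_tpow (2 + k)" by (rule cross_pow_lin[OF FL]) simp
  note FkL = cross_pow_lin[OF FL k]
  have TL: "T (2 + k) 1 \<in> lin_tpow (2 + k)" by (intro braid_gen_lin) auto
  note Tt = lin_tpow_in[OF TL t]
  show ?thesis
  proof (rule tensor_append_eqI[of _ 2 k])
    show "cross_pow F (2 + k) (T (2 + k) 1 t) \<in> tpow (2 + k)"
      "map_tensor_id (2 + k) (T (2 + k) 1) (cross_pow F (2 + k) t) \<in> tpow (2 + k)"
      by (intro lin_tpow_in[OF FnL] Tt, intro map_tensor_id_tpow TL)
    fix a w :: "'i list" assume a: "length a = 2" and w: "length w = k"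
    have ts: "(\<lambda>v. t (b @ v)) \<in> tpow k" if "b \<in> words 2" for b
      using slice_left[OF t] that by (simp add: words_length)
    have Ts: "cross_pow F k (\<lambda>v. T (2 + k) 1 t (b @ v)) w
        = (\<Sum>c\<in>words 2. \<sigma> (ebasis c) b *\<^sub>C cross_pow F k (\<lambda>v. t (c @ v)) w)" if b: "b \<in> words 2" for b
    proof -
      have "(\<lambda>v. T (2 + k) 1 t (b @ v)) = (\<Sum>c\<in>words 2. \<sigma> (ebasis c) b *\<^sub>C (\<lambda>v. t (c @ v)))"
      proof (rule tensor_eqI[of _ k])
        show "(\<lambda>v. T (2 + k) 1 t (b @ v)) \<in> tpow k"
          using slice_left[OF Tt] b by (simp add: words_length)
        show "(\<Sum>c\<in>words 2. \<sigma> (ebasis c) b *\<^sub>C (\<lambda>v. t (c @ v))) \<in> tpow k"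
          by (intro tpow_sum tpow_scaleC ts)
        fix v :: "'i list" assume "length v = k"
        then show "T (2 + k) 1 t (b @ v) = (\<Sum>c\<in>words 2. \<sigma> (ebasis c) b *\<^sub>C (\<lambda>v. t (c @ v))) v"
          using braid_gen_sum[OF t, of "[]" v b 1] b by (simp add: sum_fun_apply words_length mult.commute)
      qed
      then have "cross_pow F k (\<lambda>v. T (2 + k) 1 t (b @ v))
          = (\<Sum>c\<in>words 2. \<sigma> (ebasis c) b *\<^sub>C cross_pow F k (\<lambda>v. t (c @ v)))"
        using ts by (simp only:) (subst lin_tpow_sum[OF FkL], intro tpow_scaleC ts, assumption,
          intro sum.cong refl lin_tpow_scaleC[OF FkL] ts)
      then show ?thesis by (simp add: sum_fun_apply)
    qed
    have "cross_pow F (2 + k) (T (2 + k) 1 t) (a @ w)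
        = (\<Sum>b\<in>words 2. \<Sum>c\<in>words 2. (\<sigma> (ebasis c) b *\<^sub>C cross_pow F 2 (ebasis b) a) * cross_pow F k (\<lambda>v. t (c @ v)) w)"
      unfolding cross_pow_append_2[OF FL k Tt a]
      by (intro sum.cong refl) (simp only: Ts sum_distrib_left mult_scaleC_left mult_scaleC_right)
    also have "\<dots> = (\<Sum>c\<in>words 2. cross_pow F 2 (\<sigma> (ebasis c)) a * cross_pow F k (\<lambda>v. t (c @ v)) w)"
      by (subst sum.swap, intro sum.cong refl)
        (simp only: sum_distrib_right[symmetric] lin_tpow_expand_apply[OF F2L lin_tpow_in[OF lin_braiding ebasis_words]])
    also have "\<dots> = (\<Sum>c\<in>words 2. map_tensor_id 2 \<sigma> (cross_pow F 2 (ebasis c)) a * cross_pow F k (\<lambda>v. t (c @ v)) w)"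
      using F by (intro sum.cong refl) (simp add: compatible_maps_def)
    also have "\<dots> = (\<Sum>b\<in>words 2. \<sigma> (ebasis b) a *\<^sub>C
        (\<Sum>c\<in>words 2. cross_pow F 2 (ebasis c) b * cross_pow F k (\<lambda>v. t (c @ v)) w))"
      unfolding map_tensor_id_def sum_distrib_right cvs.scale_sum_right
      by (subst sum.swap) (simp only: mult_scaleC_left)
    also have "\<dots> = (\<Sum>b\<in>words 2. \<sigma> (ebasis b) a *\<^sub>C cross_pow F (2 + k) t (b @ w))"
      by (intro sum.cong refl) (simp only: cross_pow_append_2[OF FL k t] words_length)
    also have "\<dots> = map_tensor_id (2 + k) (T (2 + k) 1) (cross_pow F (2 + k) t) (a @ w)"
    proof -
      have "map_tensor_id (2 + k) (T (2 + k) 1) s ([] @ a @ w) = (\<Sum>b\<in>words 2. \<sigma> (ebasis b) a *\<^sub>C s ([] @ b @ w))"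
        for s :: "('i, 'a) tensor"
        using a w by (intro map_tensor_id_braid_gen) simp_all
      then show ?thesis by (simp only: append_Nil)
    qed
    finally show "cross_pow F (2 + k) (T (2 + k) 1 t) (a @ w)
      = map_tensor_id (2 + k) (T (2 + k) 1) (cross_pow F (2 + k) t) (a @ w)" .
  qed
qed

text \<open>A generator with i > 1 leaves the first letter alone, so peeling off one factor reduces
  it to the generator i-1 in degree n-1.\<close>

lemma cross_pow_braid_gen:
  assumes F: "F \<in> compatible_maps \<sigma>"
  shows "1 \<le> i \<Longrightarrow> i < n \<Longrightarrow> t \<in> tpow n \<Longrightarrow>
    cross_pow F n (T n i t) = map_tensor_id n (T n i) (cross_pow F n t)"
proof (induction i arbitrary: n t)
  case (Suc j)
  note FL = compatible_lin[OF F]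
  show ?case
  proof (cases "j = 0")
    case True
    then have "n = 2 + (n - 2)" using Suc.prems by simp
    then show ?thesis using cross_pow_braid_gen_1[OF F, of t "n - 2"] Suc.prems True by simp
  next
    case False
    then obtain m where m: "n = 1 + m" and j: "1 \<le> j" "j < m" and m1: "m \<ge> 1"
      using Suc.prems by (cases n) auto
    have t: "t \<in> tpow (1 + m)" using Suc.prems m by simp
    have FnL: "cross_pow F (1 + m) \<in> lin_tpow (1 + m)" by (rule cross_pow_lin[OF FL]) simp
    have TL: "T (1 + m) (1 + j) \<in> lin_tpow (1 + m)" using j by (intro braid_gen_lin) auto
    note Tt = lin_tpow_in[OF TL t]
    have "cross_pow F (1 + m) (T (1 + m) (1 + j) t) = map_tensor_id (1 + m) (T (1 + m) (1 + j)) (cross_pow F (1 + m) t)"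
    proof (rule tensor_append_eqI[of _ 1 m])
      show "cross_pow F (1 + m) (T (1 + m) (1 + j) t) \<in> tpow (1 + m)"
        "map_tensor_id (1 + m) (T (1 + m) (1 + j)) (cross_pow F (1 + m) t) \<in> tpow (1 + m)"
        by (intro lin_tpow_in[OF FnL] Tt, intro map_tensor_id_tpow TL)
      fix u w :: "'i list" assume u: "length u = 1" and w: "length w = m"
      have "cross_pow F (1 + m) (T (1 + m) (1 + j) t) (u @ w)
          = (\<Sum>u'\<in>words 1. F (ebasis u') u * map_tensor_id m (T m j) (cross_pow F m (\<lambda>v. t (u' @ v))) w)"
        unfolding cross_pow_append[OF FL m1 Tt u]
        by (intro sum.cong refl)
          (simp only: words_length braid_gen_slice_left[OF t j] Suc.IH[OF j slice_left[OF t]])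
      also have "\<dots> = (\<Sum>v\<in>words m. T m j (ebasis v) w *\<^sub>C cross_pow F (1 + m) t (u @ v))"
        unfolding cross_pow_append[OF FL m1 t u] map_tensor_id_def sum_distrib_left cvs.scale_sum_right
        by (subst sum.swap) (simp only: mult_scaleC_right)
      also have "\<dots> = map_tensor_id (1 + m) (T (1 + m) (1 + j)) (cross_pow F (1 + m) t) (u @ w)"
        unfolding map_tensor_id_braid_gen_left[OF j u w] by (simp only: map_tensor_id_def)
      finally show "cross_pow F (1 + m) (T (1 + m) (1 + j) t) (u @ w)
          = map_tensor_id (1 + m) (T (1 + m) (1 + j)) (cross_pow F (1 + m) t) (u @ w)" .
    qed
    then show ?thesis by (simp add: m)
  qed
qed simp

text \<open>The linearity clause lets the property pass to linear combinations, hence from single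
  sigma_w to shuffle operators and antisymmetrizers.\<close>

definition intertwines :: "nat \<Rightarrow> ('i, 'a::complex_algebra) tmap \<Rightarrow> ('i, complex) tmap \<Rightarrow> bool"
  where "intertwines n P f \<longleftrightarrow>
    f \<in> lin_tpow n \<and> (\<forall>t\<in>tpow n. P (f t) = map_tensor_id n f (P t))"

lemma intertwines_word_act:
  assumes F: "F \<in> compatible_maps \<sigma>" and n: "n \<ge> 1"
  shows "set js \<subseteq> {1..<n} \<Longrightarrow> intertwines n (cross_pow F n) (word_act (T n) js)"
proof (induction js)
  case Nil
  \<comment> \<open>The empty word acts as the identity, but \<open>map_tensor_id n\<close> discards
    coordinates at words of other lengths, so membership in \<open>tpow n\<close> matters.\<close>
  have "map_tensor_id n (word_act (T n) []) s = s" if "s \<in> tpow n" for s :: "('i, 'a) tensor"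
  proof (rule tensor_eqI[OF map_tensor_id_tpow that])
    fix w :: "'i list" assume "length w = n"
    then show "map_tensor_id n (word_act (T n) []) s w = s w"
      by (simp add: map_tensor_id_def sum_ebasis words_length)
  qed (rule word_act_lin, simp)
  then have "cross_pow F n (word_act (T n) [] t) = map_tensor_id n (word_act (T n) []) (cross_pow F n t)"
    if "t \<in> tpow n" for t
    using lin_tpow_in[OF cross_pow_lin[OF compatible_lin[OF F] n] that] by (metis word_act_Nil)
  then show ?case
    unfolding intertwines_def by (intro conjI ballI word_act_lin) simp
next
  case (Cons i js)
  then have i: "1 \<le> i" "i < n" and L: "word_act (T n) js \<in> lin_tpow n"
    and IH: "\<And>t. t \<in> tpow n \<Longrightarrow> cross_pow F n (word_act (T n) js t) = map_tensor_id n (word_act (T n) js) (cross_pow F n t)"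
    by (auto simp: intertwines_def)
  have "cross_pow F n (word_act (T n) (i # js) t) = map_tensor_id n (word_act (T n) (i # js)) (cross_pow F n t)"
    if t: "t \<in> tpow n" for t
    unfolding word_act_Cons cross_pow_braid_gen[OF F i lin_tpow_in[OF L t]] IH[OF t]
      map_tensor_id_comp[OF braid_gen_lin[OF i] L]
    by (simp add: map_tensor_id_def)
  then show ?case unfolding intertwines_def by (intro conjI ballI word_act_lin Cons.prems)
qed

lemma intertwines_braid_perm:
  assumes "F \<in> compatible_maps \<sigma>" "n \<ge> 1" "w permutes {1..n}"
  shows "intertwines n (cross_pow F n) (Tw n w)"
proof -
  have "reduced_word n w (SOME js. reduced_word n w js)" using reduced_word_exists[OF assms(3)] by (rule someI_ex)
  then show ?thesis
    using intertwines_word_act[OF assms(1,2)] by (auto simp: braid_perm_def word_act_def[symmetric] reduced_word_iff)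
qed

lemma intertwines_sum:
  assumes P: "P \<in> lin_tpow n" and A: "finite A" and f: "\<And>a. a \<in> A \<Longrightarrow> intertwines n P (f a)"
  shows "intertwines n P (\<lambda>t. c *\<^sub>C (\<Sum>a\<in>A. d a *\<^sub>C f a t))"
  unfolding intertwines_def
proof (intro conjI ballI)
  have fL: "f a \<in> lin_tpow n" if "a \<in> A" for a using f[OF that] by (simp add: intertwines_def)
  show "(\<lambda>t. c *\<^sub>C (\<Sum>a\<in>A. d a *\<^sub>C f a t)) \<in> lin_tpow n"
    by (intro lin_tpow_scaled lin_tpow_sum_scaleC A fL)
  fix t :: "('i, complex) tensor" assume t: "t \<in> tpow n"
  have ft: "f a t \<in> tpow n" if "a \<in> A" for a using lin_tpow_in[OF fL[OF that] t] .
  have "P (c *\<^sub>C (\<Sum>a\<in>A. d a *\<^sub>C f a t)) = c *\<^sub>C P (\<Sum>a\<in>A. d a *\<^sub>C f a t)"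
    by (intro lin_tpow_scaleC[OF P] tpow_sum tpow_scaleC ft)
  also have "P (\<Sum>a\<in>A. d a *\<^sub>C f a t) = (\<Sum>a\<in>A. P (d a *\<^sub>C f a t))"
    by (intro lin_tpow_sum[OF P] tpow_scaleC ft)
  also have "\<dots> = (\<Sum>a\<in>A. d a *\<^sub>C map_tensor_id n (f a) (P t))"
    using f t by (intro sum.cong refl) (simp only: lin_tpow_scaleC[OF P ft] intertwines_def)
  also have "c *\<^sub>C \<dots> = map_tensor_id n (\<lambda>t. c *\<^sub>C (\<Sum>a\<in>A. d a *\<^sub>C f a t)) (P t)"
  proof
    fix w
    have "(c *\<^sub>C (\<Sum>a\<in>A. d a *\<^sub>C map_tensor_id n (f a) (P t))) w
        = (\<Sum>a\<in>A. \<Sum>u\<in>words n. (c * (d a * f a (ebasis u) w)) *\<^sub>C P t u)"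
      by (simp add: sum_fun_apply map_tensor_id_def cvs.scale_sum_right scaleC_scaleC mult.assoc)
    also have "\<dots> = (\<Sum>u\<in>words n. (c * (\<Sum>a\<in>A. d a * f a (ebasis u) w)) *\<^sub>C P t u)"
      by (subst sum.swap) (simp only: cvs.scale_sum_left sum_distrib_left)
    also have "\<dots> = map_tensor_id n (\<lambda>t. c *\<^sub>C (\<Sum>a\<in>A. d a *\<^sub>C f a t)) (P t) w"
      by (simp add: map_tensor_id_def sum_fun_apply)
    finally show "(c *\<^sub>C (\<Sum>a\<in>A. d a *\<^sub>C map_tensor_id n (f a) (P t))) w
        = map_tensor_id n (\<lambda>t. c *\<^sub>C (\<Sum>a\<in>A. d a *\<^sub>C f a t)) (P t) w" .
  qed
  finally show "P (c *\<^sub>C (\<Sum>a\<in>A. d a *\<^sub>C f a t)) = map_tensor_id n (\<lambda>t. c *\<^sub>C (\<Sum>a\<in>A. d a *\<^sub>C f a t)) (P t)" .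
qed

text \<open>Over a noncommutative algebra the cross square of a composition need not be the
  composition of the cross squares; \<open>FG\<close> supplies this, and \<open>\<sigma>\<close> can
  then be moved past the cross square of \<open>G\<close> and that of \<open>F\<close>.\<close>

lemma comp_prod_compatible:
  assumes F: "F \<in> compatible_maps \<sigma>" and G: "G \<in> compatible_maps \<sigma>"
    and FG: "\<And>t. t \<in> tpow 2 \<Longrightarrow>
      cross_pow (comp_prod 1 F G) 2 t = comp_prod 2 (cross_pow F 2) (cross_pow G 2) t"
  shows "comp_prod 1 F G \<in> compatible_maps \<sigma>"
proof -
  note FL = compatible_lin[OF F] and GL = compatible_lin[OF G]
  let ?P = "cross_pow F 2" and ?Q = "cross_pow G 2"
  have PL: "?P \<in> lin_tpow 2" by (intro cross_pow_lin FL) simp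
  have "comp_prod 1 F G t \<in> tpow 1" for t
    unfolding tpow_def comp_prod_def
    using tpowD[OF lin_tpow_in[OF FL ebasis_words]] by (auto intro!: sum.neutral)
  then have "comp_prod 1 F G \<in> lin_tpow 1"
    using lin_tpow_add[OF GL] lin_tpow_scaleC[OF GL]
    by (auto simp: lin_maps_def comp_prod_def fun_eq_iff distrib_left sum.distrib mult_scaleC_right cvs.scale_sum_right)
  moreover have "cross_pow (comp_prod 1 F G) 2 (\<sigma> t) = map_tensor_id 2 \<sigma> (cross_pow (comp_prod 1 F G) 2 t)"
    if t: "t \<in> tpow 2" for t
  proof
    fix w
    have "comp_prod 2 ?P ?Q (\<sigma> t) w = (\<Sum>u\<in>words 2. ?P (ebasis u) w * map_tensor_id 2 \<sigma> (?Q t) u)"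
      using G t by (simp add: comp_prod_def compatible_maps_def)
    also have "\<dots> = (\<Sum>v\<in>words 2. (\<Sum>u\<in>words 2. \<sigma> (ebasis v) u *\<^sub>C ?P (ebasis u) w) * ?Q t v)"
      unfolding map_tensor_id_def sum_distrib_left sum_distrib_right
      by (subst sum.swap) (simp only: mult_scaleC_left mult_scaleC_right)
    also have "\<dots> = (\<Sum>v\<in>words 2. ?P (\<sigma> (ebasis v)) w * ?Q t v)"
      by (intro sum.cong refl)
        (simp only: lin_tpow_expand_apply[OF PL lin_tpow_in[OF lin_braiding ebasis_words]])
    also have "\<dots> = (\<Sum>v\<in>words 2. map_tensor_id 2 \<sigma> (?P (ebasis v)) w * ?Q t v)"
      using F by (intro sum.cong refl) (simp add: compatible_maps_def)
    also have "\<dots> = map_tensor_id 2 \<sigma> (comp_prod 2 ?P ?Q t) w"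
      unfolding map_tensor_id_def comp_prod_def sum_distrib_right cvs.scale_sum_right
      by (subst sum.swap) (simp only: mult_scaleC_left)
    finally show "cross_pow (comp_prod 1 F G) 2 (\<sigma> t) w
        = map_tensor_id 2 \<sigma> (cross_pow (comp_prod 1 F G) 2 t) w"
      by (simp only: FG t lin_tpow_in[OF lin_braiding t])
  qed
  ultimately show ?thesis by (simp add: compatible_maps_def)
qed

end

section \<open>Convolution powers as cross powers, and the determinant\<close>

context hecke_space
begin

lemma intertwines_sh_plus:
  assumes "F \<in> compatible_maps \<sigma>" "m + n \<ge> 1"
  shows "intertwines (m + n) (cross_pow F (m + n)) (sh_plus q \<sigma> m n)"
  unfolding sh_plus_eq[abs_def]
  by (intro intertwines_sum cross_pow_lin compatible_lin intertwines_braid_perm shuffles_permutes assms finite_shuffles)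

lemma intertwines_antisymmetrizer:
  assumes "F \<in> compatible_maps \<sigma>" "n \<ge> 1"
  shows "intertwines n (cross_pow F n) (antisymmetrizer q \<sigma> n)"
  unfolding antisymmetrizer_eq[abs_def]
  by (intro intertwines_sum cross_pow_lin compatible_lin intertwines_braid_perm assms finite_permutations) simp_all

text \<open>The characterization of \<open>\<Phi>\<close> in the definition of the convolution determines it only on the tensor
  product of the exterior powers; this is enough because \<open>z = (id \<otimes> A\<^sup>(\<^sup>n\<^sup>)) t\<close> for some \<open>t\<close>.\<close>

lemma conv_pow_eq_cross_pow:
  assumes F: "F \<in> compatible_maps \<sigma>" and "n \<ge> 1" "z \<in> qext q \<sigma> n"
  shows "conv_pow q \<sigma> F n z = cross_pow F n z"
  using assms(2,3)
proof (induction n arbitrary: z)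
  case (Suc n)
  note FL = compatible_lin[OF F]
  show ?case
  proof (cases "n = 0")
    case False
    then have n: "n \<ge> 1" by simp
    note FnL = cross_pow_lin[OF FL n]
    let ?A = "antisymmetrizer q \<sigma> n" and ?N = "1 + n"
    define P where "P \<Phi> \<longleftrightarrow> \<Phi> \<in> lin_tpow ?N \<and> (\<forall>\<alpha>\<in>qext q \<sigma> 1. \<forall>\<beta>\<in>qext q \<sigma> n.
       \<Phi> (tprod \<alpha> \<beta>) = qext_alg_mult q \<sigma> 1 n (F \<alpha>) (conv_pow q \<sigma> F n \<beta>))" for \<Phi> :: "('i, 'a) tmap"
    \<comment> \<open>An explicit candidate for the chosen extension, built from the cross power on
      all of the tensor power. By the induction hypothesis it has the prescribed values on products,
      so the choice is not vacuous.\<close>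
    define \<Psi> where "\<Psi> t = map_tensor_id ?N (sh_plus q \<sigma> 1 n) (map_tensor 1 n F (cross_pow F n) t)" for t
    note MTL = map_tensor_lin[OF FL FnL] and ShL = sh_plus_lin[of 1 n]
    have "\<Psi> \<in> lin_tpow ?N"
      unfolding lin_maps_def mem_Collect_eq \<Psi>_def
    proof (intro conjI ballI allI)
      fix x y :: "('i, complex) tensor" and c assume x: "x \<in> tpow ?N" and y: "y \<in> tpow ?N"
      show "map_tensor_id ?N (sh_plus q \<sigma> 1 n) (map_tensor 1 n F (cross_pow F n) (x + y))
        = map_tensor_id ?N (sh_plus q \<sigma> 1 n) (map_tensor 1 n F (cross_pow F n) x)
          + map_tensor_id ?N (sh_plus q \<sigma> 1 n) (map_tensor 1 n F (cross_pow F n) y)"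
        unfolding lin_tpow_add[OF MTL x y] by (rule map_tensor_id_lin[OF ShL])
    next
      fix x :: "('i, complex) tensor" and c assume x: "x \<in> tpow ?N"
      show "map_tensor_id ?N (sh_plus q \<sigma> 1 n) (map_tensor 1 n F (cross_pow F n) (c *\<^sub>C x))
        = c *\<^sub>C map_tensor_id ?N (sh_plus q \<sigma> 1 n) (map_tensor 1 n F (cross_pow F n) x)"
        unfolding lin_tpow_scaleC[OF MTL x] by (rule map_tensor_id_lin[OF ShL])
    qed (rule map_tensor_id_tpow[OF ShL])
    moreover have "\<Psi> (tprod \<alpha> \<beta>) = qext_alg_mult q \<sigma> 1 n (F \<alpha>) (conv_pow q \<sigma> F n \<beta>)"
      if "\<alpha> \<in> qext q \<sigma> 1" "\<beta> \<in> qext q \<sigma> n" for \<alpha> \<beta>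
      using that alt_tpow qext_eq_alt[of 1] qext_eq_alt[OF n]
      by (simp add: \<Psi>_def qext_alg_mult_def map_tensor_tprod[OF FL FnL, simplified] Suc.IH[OF n])
    ultimately have P\<Psi>: "P \<Psi>" by (simp add: P_def)
    \<comment> \<open>The image of id x A^(n) is spanned by the products of e_u with A^(n) e_v,
      whose factors lie in exterior powers; there every admissible extension has the same prescribed
      value.\<close>
    have unique: "\<Phi> (map_tensor 1 n id ?A t) = \<Psi> (map_tensor 1 n id ?A t)" if \<Phi>: "P \<Phi>" for \<Phi> t
    proof -
      have gen: "tprod (ebasis u) (?A (ebasis v)) \<in> tpow ?N"
        "\<Phi> (tprod (ebasis u) (?A (ebasis v))) = \<Psi> (tprod (ebasis u) (?A (ebasis v)))"
        if "u \<in> words 1" "v \<in> words n" for u v :: "'i list"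
      proof -
        show "tprod (ebasis u) (?A (ebasis v)) \<in> tpow ?N"
          by (intro tprod_tpow lin_tpow_in[OF antisymmetrizer_lin] ebasis_words that)
        have "ebasis u \<in> qext q \<sigma> 1" using in_qext.gen[OF ebasis_words[OF that(1)]] by (simp add: qext_def)
        moreover have "?A (ebasis v) \<in> qext q \<sigma> n"
          using antisymmetrizer_qext[of "ebasis v" "n - 1"] n ebasis_words[OF that(2)] by simp
        ultimately show "\<Phi> (tprod (ebasis u) (?A (ebasis v))) = \<Psi> (tprod (ebasis u) (?A (ebasis v)))"
          using \<Phi> P\<Psi> by (simp add: P_def)
      qed
      have expand: "\<Theta> (map_tensor 1 n id ?A t)
          = (\<Sum>u\<in>words 1. \<Sum>v\<in>words n. t (u @ v) *\<^sub>C \<Theta> (tprod (ebasis u) (?A (ebasis v))))"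
        if "P \<Theta>" for \<Theta>
      proof -
        have L: "\<Theta> \<in> lin_tpow ?N" using that by (simp add: P_def)
        show ?thesis
          unfolding map_tensor_def id_apply
          by (subst lin_tpow_sum[OF L], intro tpow_sum tpow_scaleC gen(1), assumption+, intro sum.cong refl,
              subst lin_tpow_sum[OF L], intro tpow_scaleC gen(1), assumption+, intro sum.cong refl
              lin_tpow_scaleC[OF L] gen(1))
      qed
      show ?thesis unfolding expand[OF \<Phi>] expand[OF P\<Psi>] by (intro sum.cong refl) (simp only: gen(2))
    qed
    have z: "z \<in> alt ?N" using Suc.prems qext_eq_alt[of ?N] by simp
    obtain t where t: "qcoprod q \<sigma> 1 n z = map_tensor 1 n id ?A t" "qcoprod q \<sigma> 1 n z = z"
      using qcoprod_alt[OF z] by metis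
    have "conv_pow q \<sigma> F (Suc n) z = (SOME \<Phi>. P \<Phi>) (qcoprod q \<sigma> 1 n z)"
      using n by (simp add: convolution_def P_def)
    also have "\<dots> = \<Psi> (qcoprod q \<sigma> 1 n z)"
      unfolding t(1) by (rule unique, rule someI[of P, OF P\<Psi>])
    also have "\<dots> = map_tensor_id ?N (sh_plus q \<sigma> 1 n) (cross_pow F ?N z)"
      unfolding t(2) \<Psi>_def using n by simp
    \<comment> \<open>The shuffle operator is moved inside the cross power because there it meets
      \<open>z\<close>, which it fixes.\<close>
    also have "\<dots> = cross_pow F ?N (sh_plus q \<sigma> 1 n z)"
      using intertwines_sh_plus[OF F, of 1 n] alt_tpow[OF z] by (simp add: intertwines_def)
    finally show ?thesis by (simp only: sh_plus_1_alt[OF z] plus_1_eq_Suc)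
  qed simp
qed simp

text \<open>The antisymmetrizer fixes \<open>\<omega>\<close> and commutes with the cross power, so
  it also fixes the image of \<open>\<omega>\<close>; every column of its matrix is a multiple of
  \<open>\<omega>\<close>.\<close>

lemma cross_pow_top:
  assumes F: "F \<in> compatible_maps \<sigma>" and M: "M \<ge> 1" and span: "qext q \<sigma> M = cvs.span {\<omega>}"
  shows "\<exists>a. cross_pow F M \<omega> = tcoeff \<omega> a"
proof -
  let ?A = "antisymmetrizer q \<sigma> M"
  have \<omega>: "\<omega> \<in> alt M" using span qext_eq_alt[OF M] by (auto intro: cvs.span_base)
  have "\<exists>c. ?A (ebasis u) = c *\<^sub>C \<omega>" if "u \<in> words M" for u
    using antisymmetrizer_qext[of "ebasis u" "M - 1"] M ebasis_words[OF that] span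
    by (auto simp: cvs.span_singleton)
  then obtain c where c: "\<And>u. u \<in> words M \<Longrightarrow> ?A (ebasis u) = c u *\<^sub>C \<omega>" by metis
  have "cross_pow F M \<omega> = map_tensor_id M ?A (cross_pow F M \<omega>)"
    using intertwines_antisymmetrizer[OF F M] alt_tpow[OF \<omega>] antisymmetrizer_alt[OF \<omega>]
    by (auto simp: intertwines_def)
  also have "\<dots> = tcoeff \<omega> (\<Sum>u\<in>words M. c u *\<^sub>C cross_pow F M \<omega> u)"
    unfolding map_tensor_id_def tcoeff_def
    by (intro ext) (simp add: c cvs.scale_sum_right scaleC_scaleC mult.commute)
  finally show ?thesis by blast
qed

text \<open>A nonzero coordinate of \<open>\<omega>\<close> determines the coefficient, which
  justifies the definite description in \<open>qdet\<close>.\<close>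

lemma qdet_eqI:
  assumes F: "F \<in> compatible_maps \<sigma>" and M: "M \<ge> 1" and span: "qext q \<sigma> M = cvs.span {\<omega>}"
    and \<omega>: "\<omega> \<noteq> 0" and a: "cross_pow F M \<omega> = tcoeff \<omega> a"
  shows "qdet q \<sigma> M \<omega> F = a"
  unfolding qdet_def
proof (rule the_equality)
  have "\<omega> \<in> qext q \<sigma> M" using span by (auto intro: cvs.span_base)
  then have conv: "conv_pow q \<sigma> F M \<omega> = tcoeff \<omega> a" using conv_pow_eq_cross_pow[OF F M] a by simp
  then show "conv_pow q \<sigma> F M \<omega> = tcoeff \<omega> a" .
  fix b assume "conv_pow q \<sigma> F M \<omega> = tcoeff \<omega> b"
  with conv have "\<omega> w *\<^sub>C a = \<omega> w *\<^sub>C b" for w by (metis tcoeff_def)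
  moreover obtain w where "\<omega> w \<noteq> 0" using \<omega> by (auto simp: fun_eq_iff)
  ultimately show "b = a" by (metis cvs.scale_left_imp_eq)
qed

end

theorem theorem6p10:
  fixes q :: complex
    and \<sigma> :: "('i::finite, complex) tmap"
    and F G :: "('i, 'a::complex_algebra) tmap"
    and M :: nat and \<omega> :: "('i, complex) tensor"
  assumes "q \<noteq> 0" and "\<And>n. n \<ge> 1 \<Longrightarrow> (q powi -2) ^ n \<noteq> 1"
    and "braiding \<sigma>" and "hecke_type q \<sigma>"
    and "F \<in> compatible_maps \<sigma>" and "G \<in> compatible_maps \<sigma>"
    and "\<And>k t. k \<ge> 1 \<Longrightarrow> t \<in> tpow k \<Longrightarrow>
           cross_pow (comp_prod 1 F G) k t = comp_prod k (cross_pow F k) (cross_pow G k) t"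
    and "braiding_rank q \<sigma> M" and "qext q \<sigma> M = cvs.span {\<omega>}"
  shows "qdet q \<sigma> M \<omega> (comp_prod 1 F G) = qdet q \<sigma> M \<omega> F * qdet q \<sigma> M \<omega> G"
proof -
  interpret hecke_space \<sigma> q
    by unfold_locales (use assms in auto)
  note F = assms(5) and G = assms(6) and FG = assms(7) and span = assms(9)
  have M: "M \<ge> 1" and dim: "cvs.dim (qext q \<sigma> M) = 1" using assms(8) by (auto simp: braiding_rank_def)
  have \<omega>: "\<omega> \<noteq> 0"
  proof
    assume "\<omega> = 0"
    then have "cvs.dim (qext q \<sigma> M) = cvs.dim (cvs.span ({} :: ('i, complex) tensor set))" by (simp add: span)
    also have "\<dots> = 0" by (simp only: cvs.dim_span cvs.dim_eq_card_independent[OF cvs.independent_empty] card.empty)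
    finally show False using dim by simp
  qed
  have tpow: "\<omega> \<in> tpow M"
    using span qext_eq_alt[OF M] alt_tpow by (auto intro: cvs.span_base)
  obtain a b where a: "cross_pow F M \<omega> = tcoeff \<omega> a" and b: "cross_pow G M \<omega> = tcoeff \<omega> b"
    using cross_pow_top[OF _ M span] F G by metis
  \<comment> \<open>The map \<open>G\<close> contributes the constant right factor \<open>b\<close>
    to every coordinate of \<open>\<omega>\<close>; pulling it out leaves the cross power of
    \<open>F\<close> at \<open>\<omega>\<close>, so the product appears in the order a b.\<close>
  have "cross_pow (comp_prod 1 F G) M \<omega> w = tcoeff \<omega> (a * b) w" for w
  proof -
    have "cross_pow (comp_prod 1 F G) M \<omega> w = (\<Sum>u\<in>words M. cross_pow F M (ebasis u) w * \<omega> u *\<^sub>C b)"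
      unfolding FG[OF M tpow] by (simp add: comp_prod_def b tcoeff_def)
    also have "\<dots> = cross_pow F M \<omega> w * b"
      unfolding lin_tpow_expand_apply[OF cross_pow_lin[OF compatible_lin[OF F] M] tpow] sum_distrib_right
      by (simp only: mult_scaleC_left mult_scaleC_right)
    finally show ?thesis by (simp add: a tcoeff_def mult_scaleC_left)
  qed
  then have "cross_pow (comp_prod 1 F G) M \<omega> = tcoeff \<omega> (a * b)" by blast
  then show ?thesis
    using qdet_eqI[OF F M span \<omega> a] qdet_eqI[OF G M span \<omega> b]
      qdet_eqI[OF comp_prod_compatible[OF F G] M span \<omega>] FG[of 2] by simp
qed

end
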